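(* Let $i\in\{1,2\}$ and let $n$ be a positive integer. Then $$\sum_{\lambda \in \mathcal{N}_i(n)}\delta(\lambda)=\sum_{\lambda \in \mathcal{R}_i(n)}(-1)^{\mathrm{size}(\lambda)}.$$
   Context: A partition of a positive integer $n$ is a non-increasing sequence of positive integers $\lambda=(\lambda_1,\dots,\lambda_r)$ with $\lambda_1+\cdots+\lambda_r=n$; the $\lambda_j$ are its parts, $|\lambda|=n$, and $\mathrm{size}(\lambda)=r$ is its number of parts. For $i\in\{1,2\}$, $\mathcal{N}_i(n)$ (neighborly partitions) is the set of partitions $\lambda$ of $n$ such that: (1) for every part $\lambda_j$ there is an index $l\neq j$ with $|\lambda_l-\lambda_j|\le 1$; (2) every part value occurs at most twice; (3) every part is $\ge 3-i$. For $\lambda\in\mathcal{N}_i(n)$, define the simple graph $G_\lambda$: its vertices are in bijection with the parts of $\lambda$; a part value $h$ of multiplicity $1$ gives one vertex $x_h$, a part value $h$ of multiplicity $2$ gives two vertices $x_h,y_h$. The edges are $\{x_{h+1},x_h\}$ whenever both $x_{h+1},x_h$ are vertices, and $\{x_l,y_l\}$ whenever both $x_l,y_l$ are vertices. The signature is $\delta(\lambda)=\sum_H(-1)^{|E(H)|}$, where $H$ ranges over the subgraphs of $G_\lambda$ with $V(H)=V(G_\lambda)$ and having no isolated vertices (every vertex of $H$ is an endpoint of an edge of $H$). $\mathcal{R}_i(n)$ is the set of partitions of $n$ whose parts are pairwise distinct, all $\ge 3-i$, and all congruent to $0$, $i$ or $-i$ modulo $5$. *)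

theory Defs
  imports "HOL-Number_Theory.Cong"
begin

definition partitions_of :: "nat \<Rightarrow> nat list set" where
  "partitions_of n =
     {xs. sorted_wrt (\<ge>) xs \<and> (\<forall>x\<in>set xs. x > 0) \<and> sum_list xs = n}"

definition neighborly :: "nat \<Rightarrow> nat \<Rightarrow> nat list set" where
  "neighborly i n =
     {xs \<in> partitions_of n.
        (\<forall>j<length xs. \<exists>l<length xs. l \<noteq> j \<and> \<bar>int (xs ! l) - int (xs ! j)\<bar> \<le> 1) \<and>
        (\<forall>h. count_list xs h \<le> 2) \<and>
        (\<forall>x\<in>set xs. x \<ge> 3 - i)}"

datatype vertex = X nat | Y nat

record 'v sgraph =
  verts :: "'v set"
  edges :: "'v set set"

definition simple_graph :: "'v sgraph \<Rightarrow> bool" where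
  "simple_graph G \<longleftrightarrow> (\<forall>e\<in>edges G. e \<subseteq> verts G \<and> card e = 2)"

definition subgraph :: "'v sgraph \<Rightarrow> 'v sgraph \<Rightarrow> bool" where
  "subgraph H G \<longleftrightarrow> simple_graph H \<and> verts H \<subseteq> verts G \<and> edges H \<subseteq> edges G"

definition no_isolated :: "'v sgraph \<Rightarrow> bool" where
  "no_isolated H \<longleftrightarrow> (\<forall>v\<in>verts H. \<exists>e\<in>edges H. v \<in> e)"

definition partition_verts :: "nat list \<Rightarrow> vertex set" where
  "partition_verts xs = {X h |h. h \<in> set xs} \<union> {Y h |h. count_list xs h = 2}"

definition partition_graph :: "nat list \<Rightarrow> vertex sgraph" where
  "partition_graph xs =
     \<lparr>verts = partition_verts xs,
      edges = {{X (h + 1), X h} |h. X (h + 1) \<in> partition_verts xs \<and> X h \<in> partition_verts xs}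
            \<union> {{X l, Y l} |l. X l \<in> partition_verts xs \<and> Y l \<in> partition_verts xs}\<rparr>"

definition signature :: "nat list \<Rightarrow> int" where
  "signature xs =
     (\<Sum>H | subgraph H (partition_graph xs) \<and> verts H = verts (partition_graph xs) \<and> no_isolated H.
        (-1) ^ card (edges H))"

definition distinct_RR :: "nat \<Rightarrow> nat \<Rightarrow> nat list set" where
  "distinct_RR i n =
     {xs \<in> partitions_of n.
        distinct xs \<and>
        (\<forall>x\<in>set xs. x \<ge> 3 - i \<and>
           ([int x = 0] (mod 5) \<or> [int x = int i] (mod 5) \<or> [int x = - int i] (mod 5)))}"

text \<open>The index sets of all the sums are finite, so none of these sums takes the default value 0
  that \<^const>\<open>sum\<close> has on infinite sets.\<close>

lemma finite_partitions_of: "finite (partitions_of n)"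
proof (rule finite_subset)
  have "length xs \<le> sum_list xs" if "\<forall>x\<in>set xs. x > 0" for xs :: "nat list"
    using that by (induction xs) auto
  then show "partitions_of n \<subseteq> {xs. set xs \<subseteq> {..n} \<and> length xs \<le> n}"
    by (auto simp: partitions_of_def intro: member_le_sum_list)
  show "finite {xs. set xs \<subseteq> {..n} \<and> length xs \<le> n}"
    by (rule finite_lists_length_le) simp
qed

lemma finite_neighborly: "finite (neighborly i n)"
  by (rule finite_subset[OF _ finite_partitions_of[of n]]) (auto simp: neighborly_def)

lemma finite_distinct_RR: "finite (distinct_RR i n)"
  by (rule finite_subset[OF _ finite_partitions_of[of n]]) (auto simp: distinct_RR_def)

lemma finite_partition_verts: "finite (partition_verts xs)"
proof (rule finite_subset)
  show "partition_verts xs \<subseteq> X ` set xs \<union> Y ` set xs"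
    by (auto simp: partition_verts_def) (metis count_notin image_eqI zero_neq_numeral)
qed simp

lemma simple_partition_graph: "simple_graph (partition_graph xs)"
  by (auto simp: simple_graph_def partition_graph_def)

lemma finite_subgraphs: "finite {H. subgraph H (partition_graph xs)}"
proof (rule finite_subset)
  let ?V = "partition_verts xs"
  show "{H. subgraph H (partition_graph xs)} \<subseteq>
          (\<lambda>(V, E). \<lparr>verts = V, edges = E\<rparr>) ` (Pow ?V \<times> Pow (Pow ?V))"
  proof
    fix H assume "H \<in> {H. subgraph H (partition_graph xs)}"
    then have "verts H \<subseteq> ?V" "edges H \<subseteq> Pow ?V"
      by (auto simp: subgraph_def simple_graph_def partition_graph_def)
    moreover have "H = (\<lambda>(V, E). \<lparr>verts = V, edges = E\<rparr>) (verts H, edges H)"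
      by simp
    ultimately show "H \<in> (\<lambda>(V, E). \<lparr>verts = V, edges = E\<rparr>) ` (Pow ?V \<times> Pow (Pow ?V))"
      by blast
  qed
qed (simp add: finite_partition_verts)

end

theory Submission
  imports Defs "HOL-Computational_Algebra.Formal_Power_Series" "HOL-Library.Multiset"
begin

text \<open>
  A spanning subgraph of \<open>G\<^sub>\<lambda>\<close> without isolated vertices is a finite set of edges of the forms
  \<open>{x\<^sub>h\<^sub>+\<^sub>1, x\<^sub>h}\<close> and \<open>{x\<^sub>h, y\<^sub>h}\<close>, and \<open>\<lambda>\<close> can be read off the vertices it covers. So the left-hand
  side is the coefficient of \<open>q\<^sup>n\<close> in the sum of \<open>(-1)\<^bsup>|E|\<^esup> q\<^bsup>wt E\<^esup>\<close> over all finite sets \<open>E\<close> of such edges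
  with \<open>h \<ge> 3 - i\<close>, where \<open>wt E\<close> adds up the indices of the vertices covered by \<open>E\<close>. Choosing the
  edges in the order of increasing \<open>h\<close> gives a recursion for this generating function \<open>W\<^sub>k\<close> (all edges
  with \<open>h \<ge> k\<close>), and modulo \<open>q\<^sup>M\<close> the recursion determines \<open>W\<^sub>k\<close>. It is also satisfied by Rogers'
  series \<open>\<Sum>n. (-1)\<^sup>n x\<^sup>2\<^sup>n q\<^bsup>n(5n+1)/2\<^esup> (1 - x\<^sup>2q\<^bsup>4n+2\<^esup>) (xq;q)\<^sub>n / (q;q)\<^sub>n\<close> at \<open>x = q\<^bsup>k-1\<^esup>\<close>. For \<open>k = 1\<close> this is a theta
  series, and for \<open>k = 2\<close> it is one after multiplication by \<open>1 - q\<close>. The Jacobi triple product turns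
  them into the products whose coefficients are the right-hand side.
\<close>

section \<open>Congruence of formal power series\<close>

text \<open>Congruence modulo \<open>fps_X ^ M\<close>. Infinite products and series enter only
  through finite truncations compared in this sense, so no convergence is involved.\<close>

definition fps_cong :: "nat \<Rightarrow> 'a::comm_ring_1 fps \<Rightarrow> 'a fps \<Rightarrow> bool" where
  "fps_cong M f g \<longleftrightarrow> (\<forall>n<M. fps_nth f n = fps_nth g n)"

lemma fps_cong_refl [simp]: "fps_cong M f f"
  by (simp add: fps_cong_def)

lemma fps_cong_sym: "fps_cong M f g \<Longrightarrow> fps_cong M g f"
  by (simp add: fps_cong_def)

lemma fps_cong_trans [trans]: "fps_cong M f g \<Longrightarrow> fps_cong M g h \<Longrightarrow> fps_cong M f h"
  by (simp add: fps_cong_def)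

text \<open>The generic substitution rules for calculations lead to runaway higher-order unification here.\<close>

lemma fps_cong_eq_trans [trans]: "fps_cong M f g \<Longrightarrow> g = h \<Longrightarrow> fps_cong M f h"
  by simp

lemma eq_fps_cong_trans [trans]: "f = g \<Longrightarrow> fps_cong M g h \<Longrightarrow> fps_cong M f h"
  by simp

lemma fps_cong_mono: "fps_cong M f g \<Longrightarrow> M' \<le> M \<Longrightarrow> fps_cong M' f g"
  by (simp add: fps_cong_def)

lemma fps_cong_add: "fps_cong M f g \<Longrightarrow> fps_cong M f' g' \<Longrightarrow> fps_cong M (f + f') (g + g')"
  by (simp add: fps_cong_def)

lemma fps_cong_diff: "fps_cong M f g \<Longrightarrow> fps_cong M f' g' \<Longrightarrow> fps_cong M (f - f') (g - g')"
  by (simp add: fps_cong_def)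

lemma fps_cong_mult: "fps_cong M f g \<Longrightarrow> fps_cong M f' g' \<Longrightarrow> fps_cong M (f * f') (g * g')"
  by (auto simp: fps_cong_def fps_mult_nth intro!: sum.cong)

lemma fps_cong_sum:
  "(\<And>x. x \<in> A \<Longrightarrow> fps_cong M (f x) (g x)) \<Longrightarrow> fps_cong M (\<Sum>x\<in>A. f x) (\<Sum>x\<in>A. g x)"
  by (simp add: fps_cong_def fps_sum_nth)

lemma fps_cong_X_power_mult: "M \<le> e \<Longrightarrow> fps_cong M (fps_X ^ e * f) 0"
  by (simp add: fps_cong_def fps_X_power_mult_nth)

text \<open>As \<open>u\<close> has constant term 1, coefficient \<open>n\<close> of
  \<open>u * f\<close> is that of \<open>f\<close> plus terms in earlier coefficients of
  \<open>f\<close>, which agree with those of \<open>g\<close> by induction.\<close>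

lemma fps_cong_mult_cancel:
  fixes u f g :: "'a::idom fps"
  assumes "fps_cong M (u * f) (u * g)" and "fps_nth u 0 = 1"
  shows "fps_cong M f g"
  unfolding fps_cong_def
proof (intro allI impI)
  fix n assume "n < M"
  then show "fps_nth f n = fps_nth g n"
  proof (induction n rule: less_induct)
    case (less n)
    have "fps_nth (u * h) n = fps_nth h n + (\<Sum>i=1..n. fps_nth u i * fps_nth h (n - i))" for h
      by (simp add: fps_mult_nth sum.atLeast_Suc_atMost assms(2))
    moreover have "(\<Sum>i=1..n. fps_nth u i * fps_nth f (n - i)) =
        (\<Sum>i=1..n. fps_nth u i * fps_nth g (n - i))"
      using less by (intro sum.cong) auto
    moreover have "fps_nth (u * f) n = fps_nth (u * g) n"
      using assms(1) less.prems by (simp add: fps_cong_def)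
    ultimately show ?case by simp
  qed
qed

section \<open>Gaussian binomials and the Jacobi triple product\<close>

text \<open>The Gaussian binomial, given by a q-Pascal rule rather than as a quotient, so that it
  makes sense in every commutative ring.\<close>

fun qbinomial :: "'a::comm_ring_1 \<Rightarrow> nat \<Rightarrow> nat \<Rightarrow> 'a" where
  "qbinomial q n 0 = 1"
| "qbinomial q 0 (Suc k) = 0"
| "qbinomial q (Suc n) (Suc k) = q ^ Suc k * qbinomial q n (Suc k) + qbinomial q n k"

definition qfact :: "'a::comm_ring_1 \<Rightarrow> nat \<Rightarrow> 'a" where
  "qfact q n = (\<Prod>j<n. 1 - q ^ Suc j)"

lemma qfact_0 [simp]: "qfact q 0 = 1"
  and qfact_Suc: "qfact q (Suc n) = qfact q n * (1 - q ^ Suc n)"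
  by (simp_all add: qfact_def)

lemma qbinomial_eq_0: "n < k \<Longrightarrow> qbinomial q n k = 0"
  by (induction q n k rule: qbinomial.induct) auto

lemma qbinomial_self [simp]: "qbinomial q n n = 1"
  by (induction n) (auto simp: qbinomial_eq_0)

text \<open>The closed form with denominators cleared. With \<open>n = m + k\<close>, the q-Pascal
  rule matches the splitting \<open>1 - q ^ n = q ^ k * (1 - q ^ m) + (1 - q ^ k)\<close>.\<close>

lemma qbinomial_qfact: "qbinomial q (m + k) k * (qfact q k * qfact q m) = qfact q (m + k)"
proof (induction "m + k" arbitrary: m k)
  case (Suc n)
  show ?case
  proof (cases "m = 0 \<or> k = 0")
    case False
    then obtain m' k' where mk: "m = Suc m'" "k = Suc k'"
      by (metis not0_implies_Suc)
    have "qbinomial q (m' + Suc k') (Suc k') * (qfact q (Suc k') * qfact q m') =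
        qfact q (m' + Suc k')"
      and "qbinomial q (Suc m' + k') k' * (qfact q k' * qfact q (Suc m')) = qfact q (Suc m' + k')"
      by (intro Suc.hyps(1), use Suc.hyps(2) mk in simp)+
    note IH = this[unfolded add_Suc add_Suc_right]
    have "qbinomial q (m + k) k * (qfact q k * qfact q m) =
        q ^ Suc k' * (1 - q ^ Suc m') *
          (qbinomial q (Suc (m' + k')) (Suc k') * (qfact q (Suc k') * qfact q m')) +
        (1 - q ^ Suc k') * (qbinomial q (Suc (m' + k')) k' * (qfact q k' * qfact q (Suc m')))"
      unfolding mk add_Suc add_Suc_right qbinomial.simps qfact_Suc
      by (simp only: algebra_simps)
    also have "\<dots> = (1 - q ^ Suc k' * q ^ Suc m') * qfact q (Suc (m' + k'))"
      unfolding IH by (simp only: algebra_simps) simp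
    also have "\<dots> = qfact q (m + k)"
      by (simp add: mk qfact_Suc power_add mult_ac)
    finally show ?thesis .
  qed auto
qed auto

lemma choose_two_Suc: "Suc n choose 2 = n + (n choose 2)"
  by (simp add: numeral_2_eq_2)

lemma choose_two_add: "(m + n) choose 2 = (m choose 2) + (n choose 2) + m * n"
  by (induction m) (auto simp: choose_two_Suc)

lemma choose_two_double: "2 * (n choose 2) + n = n * n"
  by (induction n) (auto simp: choose_two_Suc)

lemma prod_power_lessThan: "(\<Prod>i<n. q ^ i) = (q::'a::comm_semiring_1) ^ (n choose 2)"
  by (induction n) (auto simp: choose_two_Suc power_add binomial_eq_0 mult.commute)

text \<open>The form homogeneous in \<open>y\<close> and \<open>z\<close> allows a monomial to be
  substituted for \<open>y\<close> without negative exponents.\<close>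

theorem qbinomial_theorem:
  "(\<Prod>i<n. y + q ^ i * z) =
     (\<Sum>k\<le>n. q ^ (k choose 2) * qbinomial q n k * y ^ (n - k) * z ^ k)"
proof (induction n arbitrary: z)
  case (Suc n)
  let ?t = "\<lambda>k. q ^ (k choose 2) * y ^ (Suc n - k) * z ^ k"
  \<comment> \<open>Without the factor \<open>i = 0\<close> the product is the one for
    \<open>n\<close> at \<open>q * z\<close>, which is why the induction generalises over
    \<open>z\<close>.\<close>
  have "(\<Prod>i<Suc n. y + q ^ i * z) = (y + z) * (\<Prod>i<n. y + q ^ i * (q * z))"
    by (subst prod.lessThan_Suc_shift) (simp add: mult_ac)
  also have "\<dots> = (\<Sum>k\<le>n. ?t k * (q ^ k * qbinomial q n k)) +
                   (\<Sum>k\<le>n. ?t (Suc k) * qbinomial q n k)"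
    unfolding Suc.IH unfolding distrib_right[of y z] unfolding sum_distrib_left
    by (intro arg_cong2[of _ _ _ _ "(+)"] sum.cong refl)
       (auto simp: choose_two_Suc power_add power_mult_distrib Suc_diff_le mult_ac)
  also have "(\<Sum>k\<le>n. ?t k * (q ^ k * qbinomial q n k)) =
             (\<Sum>k\<le>Suc n. ?t k * (q ^ k * qbinomial q n k))"
    by (simp add: qbinomial_eq_0)
  also have "\<dots> = ?t 0 + (\<Sum>k\<le>n. ?t (Suc k) * (q ^ Suc k * qbinomial q n (Suc k)))"
    by (subst sum.atMost_Suc_shift) simp
  also have "\<dots> + (\<Sum>k\<le>n. ?t (Suc k) * qbinomial q n k) =
      ?t 0 + (\<Sum>k\<le>n. ?t (Suc k) * qbinomial q (Suc n) (Suc k))"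
    by (simp add: sum.distrib[symmetric] algebra_simps)
  also have "\<dots> = (\<Sum>k\<le>Suc n. q ^ (k choose 2) * qbinomial q (Suc n) k * y ^ (Suc n - k) * z ^ k)"
    by (subst sum.atMost_Suc_shift) (simp add: binomial_eq_0 mult_ac)
  finally show ?case .
qed (auto simp: binomial_eq_0)

text \<open>The \<open>q\<close>-binomial theorem with base \<open>x ^ (a + b)\<close>, \<open>y = x ^ ((a + b) * N)\<close> and
  \<open>z = - x ^ a\<close>, the common power of \<open>x\<close> being cancelled.\<close>

lemma finite_jacobi_triple_product:
  fixes x :: "'a::idom" and a b N :: nat
  assumes "x \<noteq> 0"
  defines "Q \<equiv> x ^ (a + b)"
  shows "(\<Prod>m<N. (1 - x ^ ((a + b) * m + a)) * (1 - x ^ ((a + b) * m + b))) =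
     (\<Sum>j\<le>N. (-1) ^ j * x ^ ((a + b) * (j choose 2) + a * j) * qbinomial Q (2 * N) (N + j)) +
     (\<Sum>j=1..N. (-1) ^ j * x ^ ((a + b) * (j choose 2) + b * j) * qbinomial Q (2 * N) (N - j))"
    (is "?F = ?A + ?B")
proof -
  \<comment> \<open>The monomial common to both sides: the lower \<open>N\<close> factors contribute
    \<open>(-1) ^ N * x ^ ((a + b) * (N choose 2) + a * N)\<close>, the upper ones
    \<open>x ^ ((a + b) * (N * N))\<close>.\<close>
  define C where "C = (-1) ^ N * x ^ ((a + b) * (N * N + (N choose 2)) + a * N)"
  have "C \<noteq> 0"
    using assms(1) by (simp add: C_def)
  \<comment> \<open>For \<open>i < N\<close> the term \<open>Q ^ i * x ^ a\<close> is the one to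
    factor out; with \<open>i = N - Suc m\<close> this leaves the exponent
    \<open>(a + b) * Suc m - a = (a + b) * m + b\<close>.\<close>
  have low:
    "(\<Prod>i<N. Q ^ N + Q ^ i * (- (x ^ a))) =
      (-1) ^ N * x ^ ((a + b) * (N choose 2) + a * N) *
      (\<Prod>m<N. 1 - x ^ ((a + b) * m + b))"
  proof -
    have "(\<Prod>i<N. Q ^ N + Q ^ i * (- (x ^ a))) =
        (\<Prod>m<N. Q ^ N + Q ^ (N - Suc m) * (- (x ^ a)))"
      by (subst prod.nat_diff_reindex[symmetric]) simp
    also have "\<dots> = (\<Prod>m<N. (- (x ^ a)) * Q ^ (N - Suc m) * (1 - x ^ ((a + b) * m + b)))"
    proof (rule prod.cong)
      fix m assume "m \<in> {..<N}"
      then obtain d where "N = Suc (m + d)"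
        using less_iff_Suc_add by auto
      then show "Q ^ N + Q ^ (N - Suc m) * (- (x ^ a)) =
          (- (x ^ a)) * Q ^ (N - Suc m) * (1 - x ^ ((a + b) * m + b))"
        by (simp add: Q_def algebra_simps flip: power_add power_mult)
    qed simp
    also have "\<dots> = (- (x ^ a)) ^ N * (\<Prod>m<N. Q ^ m) * (\<Prod>m<N. 1 - x ^ ((a + b) * m + b))"
      unfolding prod.distrib prod.nat_diff_reindex[of "(^) Q" N] by simp
    also have "(- (x ^ a)) ^ N * (\<Prod>m<N. Q ^ m) = (-1) ^ N * x ^ ((a + b) * (N choose 2) + a * N)"
      unfolding prod_power_lessThan power_minus[of "x ^ a"] unfolding Q_def power_mult[symmetric]
      by (simp add: power_add)
    finally show ?thesis .
  qed
  have high: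
    "(\<Prod>m<N. Q ^ N + Q ^ (m + N) * (- (x ^ a))) =
      x ^ ((a + b) * (N * N)) * (\<Prod>m<N. 1 - x ^ ((a + b) * m + a))"
  proof -
    have "(\<Prod>m<N. Q ^ N + Q ^ (m + N) * (- (x ^ a))) = (\<Prod>m<N. Q ^ N * (1 - x ^ ((a + b) * m + a)))"
      by (intro prod.cong refl) (simp add: Q_def algebra_simps flip: power_add power_mult)
    then show ?thesis
      by (simp add: prod.distrib Q_def mult_ac flip: power_mult)
  qed
  have "(\<Prod>i<N + N. Q ^ N + Q ^ i * (- (x ^ a))) =
      (\<Prod>i<N. Q ^ N + Q ^ i * (- (x ^ a))) * (\<Prod>m<N. Q ^ N + Q ^ (m + N) * (- (x ^ a)))"
    using prod.atLeastLessThan_concat[of 0 N "N + N" "\<lambda>i. Q ^ N + Q ^ i * (- (x ^ a))"]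
      prod.shift_bounds_nat_ivl[of "\<lambda>i. Q ^ N + Q ^ i * (- (x ^ a))" 0 N N]
    by (simp add: atLeast0LessThan)
  also have "\<dots> = C * ?F"
    unfolding low high C_def prod.distrib by (simp add: algebra_simps power_add)
  finally have F: "(\<Prod>i<N + N. Q ^ N + Q ^ i * (- (x ^ a))) = C * ?F" .
  let ?t = "\<lambda>k. Q ^ (k choose 2) * qbinomial Q (N + N) k * (Q ^ N) ^ (N + N - k) * (- (x ^ a)) ^ k"
  \<comment> \<open>The summation index is recentred at \<open>N\<close>; the middle index,
    \<open>j = 0\<close>, belongs to the first half only.\<close>
  have split: "{..N + N} = (\<lambda>j. N + j) ` {..N} \<union> (\<lambda>j. N - j) ` {1..N}"
  proof (intro equalityI subsetI)
    fix k assume "k \<in> {..N + N}"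
    show "k \<in> (\<lambda>j. N + j) ` {..N} \<union> (\<lambda>j. N - j) ` {1..N}"
    proof (cases "N \<le> k")
      case True
      then show ?thesis using \<open>k \<in> _\<close> by (intro UnI1 image_eqI[of _ _ "k - N"]) auto
    next
      case False
      then show ?thesis by (intro UnI2 image_eqI[of _ _ "N - k"]) auto
    qed
  qed auto
  have "(\<Sum>k\<le>N + N. ?t k) = (\<Sum>k\<in>(\<lambda>j. N + j) ` {..N}. ?t k) + (\<Sum>k\<in>(\<lambda>j. N - j) ` {1..N}. ?t k)"
    unfolding split by (intro sum.union_disjoint) auto
  also have "(\<Sum>k\<in>(\<lambda>j. N + j) ` {..N}. ?t k) = (\<Sum>j\<le>N. ?t (N + j))"
    by (simp add: sum.reindex)
  also have "(\<Sum>k\<in>(\<lambda>j. N - j) ` {1..N}. ?t k) = (\<Sum>j=1..N. ?t (N - j))"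
    by (subst sum.reindex) (auto simp: inj_on_def)
  also have "(\<Sum>j\<le>N. ?t (N + j)) = C * ?A"
    unfolding sum_distrib_left
  proof (rule sum.cong)
    fix j assume "j \<in> {..N}"
    then obtain i where N: "N = i + j"
      using le_Suc_ex by (metis add.commute atMost_iff)
    have e: "(a + b) * ((N + j) choose 2) + (a + b) * (N * i) + a * (N + j) =
        (a + b) * (N * N + (N choose 2)) + a * N + ((a + b) * (j choose 2) + a * j)"
      by (simp add: N choose_two_add algebra_simps)
    have pow: "Q ^ ((N + j) choose 2) * (Q ^ N) ^ i * x ^ (a * (N + j)) =
        x ^ ((a + b) * (N * N + (N choose 2)) + a * N) * x ^ ((a + b) * (j choose 2) + a * j)"
      unfolding Q_def power_mult[symmetric] power_add[symmetric] using e by (simp add: mult_ac)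
    have sub: "N + N - (N + j) = i"
      by (simp add: N)
    have sign: "(- (x ^ a)) ^ (N + j) = (-1) ^ N * (-1) ^ j * x ^ (a * (N + j))"
      by (subst power_minus) (simp add: power_add add_mult_distrib2 flip: power_mult)
    have "?t (N + j) = (-1) ^ N * (-1) ^ j * qbinomial Q (N + N) (N + j) *
        (Q ^ (N + j choose 2) * (Q ^ N) ^ i * x ^ (a * (N + j)))"
      unfolding sub sign by (simp only: mult_ac)
    also have "\<dots> = C * ((-1) ^ j * x ^ ((a + b) * (j choose 2) + a * j) *
        qbinomial Q (2 * N) (N + j))"
      unfolding pow C_def mult_2 sub by (simp only: mult_ac)
    finally show "?t (N + j) = C * ((-1) ^ j * x ^ ((a + b) * (j choose 2) + a * j) *
        qbinomial Q (2 * N) (N + j))" .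
  qed simp
  also have "(\<Sum>j=1..N. ?t (N - j)) = C * ?B"
    unfolding sum_distrib_left
  proof (rule sum.cong)
    fix j assume "j \<in> {1..N}"
    then obtain i where N: "N = i + j"
      using le_Suc_ex by (metis add.commute atLeastAtMost_iff)
    \<comment> \<open>Going down from \<open>N\<close>, the exponents differ by a multiple of
      \<open>j * j\<close>, which must be expressed through \<open>j choose 2\<close>.\<close>
    have "(a + b) * (2 * (j choose 2) + j) = (a + b) * (j * j)"
      by (simp only: choose_two_double)
    then have e: "(a + b) * (i choose 2) + (a + b) * (N * (N + j)) + a * i =
        (a + b) * (N * N + (N choose 2)) + a * N + ((a + b) * (j choose 2) + b * j)"
      by (simp add: N choose_two_add algebra_simps)
    have pow: "Q ^ (i choose 2) * (Q ^ N) ^ (N + j) * x ^ (a * i) =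
        x ^ ((a + b) * (N * N + (N choose 2)) + a * N) * x ^ ((a + b) * (j choose 2) + b * j)"
      unfolding Q_def power_mult[symmetric] power_add[symmetric] using e by (simp add: mult_ac)
    have sub: "N + N - i = N + j" "N - j = i"
      by (simp_all add: N)
    have sign: "(- (x ^ a)) ^ i = (-1) ^ N * (-1) ^ j * x ^ (a * i)"
      by (simp add: power_minus[of "x ^ a"] N power_add power_mult mult.assoc
          left_minus_one_mult_self)
    have "?t (N - j) = (-1) ^ N * (-1) ^ j * qbinomial Q (N + N) i *
        (Q ^ (i choose 2) * (Q ^ N) ^ (N + j) * x ^ (a * i))"
      unfolding sub sign by (simp only: mult_ac)
    also have "\<dots> = C * ((-1) ^ j * x ^ ((a + b) * (j choose 2) + b * j) *
        qbinomial Q (2 * N) (N - j))"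
      unfolding pow C_def mult_2 sub by (simp only: mult_ac)
    finally show "?t (N - j) = C * ((-1) ^ j * x ^ ((a + b) * (j choose 2) + b * j) *
        qbinomial Q (2 * N) (N - j))" .
  qed simp
  also have "(\<Sum>k\<le>N + N. ?t k) = C * ?F"
    unfolding F[symmetric] qbinomial_theorem by simp
  finally have "C * ?F = C * (?A + ?B)"
    by (simp only: distrib_left)
  with \<open>C \<noteq> 0\<close> show ?thesis by simp
qed

section \<open>The triple product modulo a power of the variable\<close>

text \<open>Because \<open>p > 0\<close>, every factor beyond the first \<open>M\<close> is
  congruent to 1, so both sides represent the same infinite product.\<close>

lemma qfact_X_power_cong:
  fixes p :: nat
  assumes "p > 0" "M \<le> m" "M \<le> n"
  shows "fps_cong M (qfact (fps_X ^ p) m) (qfact (fps_X ^ p :: 'a::comm_ring_1 fps) n)"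
proof -
  have *: "fps_cong M (qfact (fps_X ^ p) (M + d)) (qfact (fps_X ^ p :: 'a fps) M)" for d
  proof (induction d)
    case (Suc d)
    have "M + d < p * Suc (M + d)"
      using mult_le_mono1[of 1 p "Suc (M + d)"] assms(1) by simp
    then have "fps_cong M (fps_X ^ (p * Suc (M + d)) * 1 :: 'a fps) 0"
      by (intro fps_cong_X_power_mult) linarith
    then have "fps_cong M (1 - (fps_X ^ p) ^ Suc (M + d) :: 'a fps) (1 - 0)"
      by (intro fps_cong_diff) (simp_all flip: power_mult power_Suc)
    from fps_cong_mult[OF Suc this] show ?case
      by (simp add: qfact_Suc)
  qed simp
  show ?thesis
    using *[of "m - M"] *[of "n - M"] assms by (auto intro: fps_cong_trans fps_cong_sym)
qed

text \<open>The truncated form of the limit of the Gaussian binomial,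
  \<open>1 / (Q;Q)\<^sub>\<infinity>\<close>: in \<open>qbinomial_qfact\<close> all q-factorials are
  congruent, and one of them cancels.\<close>

lemma qfact_mult_qbinomial_cong:
  fixes p :: nat
  assumes "p > 0" "M \<le> m" "M \<le> k" "M \<le> N"
  shows "fps_cong M (qfact (fps_X ^ p) N * qbinomial (fps_X ^ p :: 'a::idom fps) (m + k) k) 1"
proof (rule fps_cong_mult_cancel)
  let ?Q = "fps_X ^ p :: 'a fps"
  have "qfact ?Q N * (qfact ?Q N * qbinomial ?Q (m + k) k) =
      qbinomial ?Q (m + k) k * (qfact ?Q N * qfact ?Q N)"
    by (simp add: mult_ac)
  also have "fps_cong M \<dots> (qbinomial ?Q (m + k) k * (qfact ?Q k * qfact ?Q m))"
    by (intro fps_cong_mult fps_cong_refl qfact_X_power_cong assms)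
  also have "\<dots> = qfact ?Q (m + k)"
    by (rule qbinomial_qfact)
  also have "fps_cong M \<dots> (qfact ?Q N * 1)"
    using assms by (simp add: qfact_X_power_cong)
  finally show "fps_cong M (qfact ?Q N * (qfact ?Q N * qbinomial ?Q (m + k) k)) (qfact ?Q N * 1)" .
  show "fps_nth (qfact ?Q N) 0 = 1"
    using assms(1) by (induction N) (simp_all add: qfact_Suc fps_nth_power_0)
qed

theorem jacobi_triple_product_cong:
  fixes a b M :: nat
  assumes "a > 0" "b > 0"
  shows "fps_cong M
     (\<Prod>m<2 * M. (1 - fps_X ^ ((a + b) * m + a)) * (1 - fps_X ^ ((a + b) * m + b)) *
                 (1 - fps_X ^ ((a + b) * m + (a + b))))
     (\<Sum>n\<le>2 * M. (-1) ^ n * (fps_X ^ ((a + b) * (n choose 2) + a * n) -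
                     fps_X ^ ((a + b) * (Suc n choose 2) + b * Suc n)) :: 'a::idom fps)"
    (is "fps_cong M ?P ?S")
proof -
  \<comment> \<open>This choice gives \<open>N - j \<ge> M\<close> for all \<open>j < M\<close>, so
    the Gaussian binomials there have reached their limit, while for \<open>j \<ge> M\<close> the
    monomial itself is congruent to 0.\<close>
  define N where "N = 2 * M"
  define Q where "Q = (fps_X ^ (a + b) :: 'a fps)"
  let ?e = "\<lambda>c j. (a + b) * (j choose 2) + c * j"
  let ?s = "\<lambda>c j. (-1) ^ j * fps_X ^ ?e c j :: 'a fps"
  have "?P = qfact Q N * (\<Prod>m<N. (1 - fps_X ^ ((a + b) * m + a)) * (1 - fps_X ^ ((a + b) * m + b)))"
    unfolding prod.distrib qfact_def N_def Q_def power_mult[symmetric] mult_Suc_right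
    by (simp only: mult_ac add_ac)
  also have "\<dots> = (\<Sum>j\<le>N. ?s a j * (qfact Q N * qbinomial Q (2 * N) (N + j))) +
                   (\<Sum>j=1..N. ?s b j * (qfact Q N * qbinomial Q (2 * N) (N - j)))"
    unfolding Q_def by (subst finite_jacobi_triple_product)
        (simp_all add: sum_distrib_left distrib_left mult_ac)
  also have "fps_cong M \<dots> ((\<Sum>j\<le>N. ?s a j) + (\<Sum>j=1..N. ?s b j))"
  proof (intro fps_cong_add fps_cong_sum)
    have *: "fps_cong M (?s c j * (qfact Q N * qbinomial Q (2 * N) k)) (?s c j)"
      if "c > 0" "k = N + j \<or> k = N - j" "j \<le> N" for c j k
    proof (cases "j < M")
      case True
      have "2 * N = (2 * N - k) + k"
        using that by auto
      moreover have "fps_cong M (qfact Q N * qbinomial Q ((2 * N - k) + k) k) 1"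
        unfolding Q_def using that True assms
          by (intro qfact_mult_qbinomial_cong) (auto simp: N_def)
      ultimately have "fps_cong M (?s c j * (qfact Q N * qbinomial Q (2 * N) k)) (?s c j * 1)"
        by (metis fps_cong_mult fps_cong_refl)
      then show ?thesis by simp
    next
      case False
      have "j \<le> c * j" using that by simp
      then have "M \<le> ?e c j"
        using False by linarith
      then have "fps_cong M (fps_X ^ ?e c j * f) (0 :: 'a fps)" for f
        by (rule fps_cong_X_power_mult)
      from this[of "(-1) ^ j * (qfact Q N *
          qbinomial Q (2 * N) k)"] this[of "(-1) ^ j"] show ?thesis
        by (auto simp: mult_ac intro: fps_cong_trans fps_cong_sym)
    qed
    show "fps_cong M (?s a j * (qfact Q N * qbinomial Q (2 * N) (N + j)))
        (?s a j)" if "j \<in> {..N}" for j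
      using that assms by (intro *) auto
    show "fps_cong M (?s b j * (qfact Q N * qbinomial Q (2 * N) (N - j)))
        (?s b j)" if "j \<in> {1..N}" for j
      using that assms by (intro *) auto
  qed
  \<comment> \<open>An additional term, congruent to 0, lets term \<open>n\<close> of the first sum
    pair with term \<open>Suc n\<close> of the second.\<close>
  also have "fps_cong M \<dots> ((\<Sum>j\<le>N. ?s a j) + ((\<Sum>j=1..N. ?s b j) + ?s b (Suc N)))"
  proof -
    have "Suc N \<le> b * Suc N"
      using assms mult_le_mono1[of 1 b "Suc N"] by simp
    then have "M \<le> ?e b (Suc N)"
      unfolding N_def by linarith
    from fps_cong_X_power_mult[OF this, of "(-1) ^ Suc N"] have "fps_cong M 0 (?s b (Suc N))"
      unfolding mult.commute[of "(-1) ^ Suc N :: 'a fps"] by (rule fps_cong_sym)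
    from fps_cong_add[OF fps_cong_refl[of M "(\<Sum>j\<le>N. ?s a j) + (\<Sum>j=1..N. ?s b j)"] this] show ?thesis
      by (simp only: add.right_neutral add.assoc)
  qed
  also have "(\<Sum>j=1..N. ?s b j) + ?s b (Suc N) = (\<Sum>j\<le>N. ?s b (Suc j))"
    by (simp add: sum.atLeast1_atMost_eq lessThan_Suc_atMost[symmetric])
  also have "(\<Sum>j\<le>N. ?s a j) + \<dots> = ?S"
    unfolding N_def by (simp add: sum.distrib[symmetric] algebra_simps)
  finally show ?thesis .
qed

section \<open>Rogers' series\<close>

text \<open>Multiplied by \<open>qfact q n * qfact q m\<close>, all these products become
  \<open>qfact q (Suc (m + n))\<close>; the nonvanishing of q-factorials permits cancelling.\<close>

lemma qbinomial_absorb: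
  fixes q :: "'a::idom"
  assumes "\<And>j. qfact q j \<noteq> 0"
  shows qbinomial_absorb_Suc_Suc:
      "(1 - q ^ Suc n) * qbinomial q (Suc (m + n)) (Suc n) =
          (1 - q ^ Suc (m + n)) * qbinomial q (m + n) n"
    and qbinomial_absorb_Suc:
      "(1 - q ^ Suc m) * qbinomial q (Suc (m + n)) n =
          (1 - q ^ Suc (m + n)) * qbinomial q (m + n) n"
proof -
  let ?c = "qfact q n * qfact q m"
  have c: "?c \<noteq> 0" using assms by simp
  have "(1 - q ^ Suc n) * qbinomial q (Suc (m + n)) (Suc n) * ?c = qfact q (m + Suc n)"
    using qbinomial_qfact[of q m "Suc n"] by (simp add: qfact_Suc mult_ac)
  also have "\<dots> = (1 - q ^ Suc (m + n)) * qbinomial q (m + n) n * ?c"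
    using qbinomial_qfact[of q m n] by (simp add: qfact_Suc mult_ac)
  finally show "(1 - q ^ Suc n) * qbinomial q (Suc (m + n)) (Suc n) =
      (1 - q ^ Suc (m + n)) * qbinomial q (m + n) n"
    using c by simp
  have "(1 - q ^ Suc m) * qbinomial q (Suc (m + n)) n * ?c = qfact q (Suc m + n)"
    using qbinomial_qfact[of q "Suc m" n] by (simp add: qfact_Suc mult_ac)
  also have "\<dots> = (1 - q ^ Suc (m + n)) * qbinomial q (m + n) n * ?c"
    using qbinomial_qfact[of q m n] by (simp add: qfact_Suc mult_ac)
  finally show "(1 - q ^ Suc m) * qbinomial q (Suc (m + n)) n =
      (1 - q ^ Suc (m + n)) * qbinomial q (m + n) n"
    using c by simp
qed

text \<open>Partial sums of Rogers' two series at \<open>x = q\<^sup>m\<close>, cleared of the denominator \<open>(xq;q)\<^sub>\<infinity>\<close>; the quotient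
  \<open>(xq;q)\<^sub>n / (q;q)\<^sub>n\<close> is then a Gaussian binomial and no division is needed.\<close>

definition rogers_S :: "'a::comm_ring_1 \<Rightarrow> nat \<Rightarrow> nat \<Rightarrow> 'a" where
  "rogers_S q m N = (\<Sum>n<N. (-1) ^ n * q ^ (2 * m * n + 2 * n * n + n + (n choose 2)) *
     qbinomial q (m + n) n * (1 - q ^ (2 * m + 2 + 4 * n)))"

definition rogers_T :: "'a::comm_ring_1 \<Rightarrow> nat \<Rightarrow> nat \<Rightarrow> 'a" where
  "rogers_T q m N = (\<Sum>n<N. (-1) ^ n * q ^ (2 * m * n + 2 * n * n + 2 * n + (n choose 2)) *
     qbinomial q (m + n) n * (1 - q ^ (m + 1 + 2 * n)))"

text \<open>Both relations telescope: the factors \<open>1 - q\<^bsup>m+1+2n\<^esup>\<close> and \<open>(1 - q\<^bsup>2m+2+4n\<^esup>) - q\<^sup>n (1 - q\<^bsup>m+1+2n\<^esup>)\<close> are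
  split into a multiple of \<open>1 - q\<^sup>n\<close> and a multiple of \<open>1 - q\<^bsup>m+1+n\<^esup>\<close>, and the former is absorbed into
  the preceding term. The last summand is the remainder.\<close>

lemma rogers_T_eq:
  fixes q :: "'a::idom"
  assumes "\<And>j. qfact q j \<noteq> 0"
  shows "rogers_T q m N = (1 - q ^ Suc m) * rogers_S q (Suc m) N -
    (-1) ^ N * q ^ (2 * m * N + 2 * N * N + 2 * N + (N choose 2)) *
      (1 - q ^ N) * qbinomial q (m + N) N"
proof (induction N)
  case (Suc N)
  \<comment> \<open>In terms of \<open>u\<close> and \<open>v\<close> all powers of \<open>q\<close>
    are monomials, and the induction step becomes a polynomial identity.\<close>
  define B A u v where "B = qbinomial q (m + N) N"
      and "A = (-1) ^ N * q ^ (2 * m * N + 2 * N * N + 2 * N + (N choose 2))"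
    and "u = q ^ N" and "v = q ^ m"
  \<comment> \<open>\<open>B1\<close> serves the new remainder and \<open>B2\<close> the new term of
    the series at \<open>Suc m\<close>: both shifted Gaussian binomials are reduced to
    \<open>B\<close>.\<close>
  have B1: "(1 - q ^ Suc N) * qbinomial q (Suc (m + N)) (Suc N) = (1 - q * u * v) * B"
    and B2: "(1 - q ^ Suc m) * qbinomial q (Suc (m + N)) N = (1 - q * u * v) * B"
    using qbinomial_absorb[OF assms] by (simp_all add: B_def u_def v_def power_add mult_ac)
  have e1: "(-1) ^ N * q ^ (2 * Suc m * N + 2 * N * N + N + (N choose 2)) = A * u"
    by (simp add: A_def u_def algebra_simps flip: power_add power_mult)
  have "q ^ (2 * m * Suc N + 2 * Suc N * Suc N + 2 * Suc N + (Suc N choose 2)) =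
      q ^ (2 * m * N + 2 * N * N + 2 * N + (N choose 2)) * v^2 * u^5 * q^4"
    unfolding u_def v_def power_mult[symmetric] power_add[symmetric]
    by (rule arg_cong[of _ _ "power q"]) (simp add: choose_two_Suc algebra_simps)
  then have e2: "(-1) ^ Suc N * q ^ (2 * m * Suc N + 2 * Suc N * Suc N + 2 * Suc N +
      (Suc N choose 2)) = - (A * v^2 * u^5 * q^4)"
    by (simp only: A_def power_Suc) simp
  have e3: "q ^ (2 * Suc m + 2 + 4 * N) = q^4 * v^2 * u^4" "q ^ (m + 1 + 2 * N) = q * v * u^2"
    unfolding u_def v_def power_mult[symmetric] power_add[symmetric]
    by (rule arg_cong[of _ _ "power q"]) (simp_all add: mult_ac power_add)
  have f1: "rogers_T q m (Suc N) = rogers_T q m N + A * B * (1 - q * v * u^2)"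
    unfolding rogers_T_def sum.lessThan_Suc e3 by (simp add: A_def B_def)
  have f2: "(1 - q ^ Suc m) * rogers_S q (Suc m) (Suc N) = (1 - q ^ Suc m) * rogers_S q (Suc m) N +
      A * u * ((1 - q ^ Suc m) * qbinomial q (Suc (m + N)) N) * (1 - q^4 * v^2 * u^4)"
    unfolding rogers_S_def sum.lessThan_Suc e3 e1 by (simp add: algebra_simps)
  have f4: "(-1) ^ Suc N * q ^ (2 * m * Suc N + 2 * Suc N * Suc N + 2 * Suc N +
      (Suc N choose 2)) * (1 - q ^ Suc N) * qbinomial q (m + Suc N) (Suc N)
     = - (A * v^2 * u^5 * q^4) * ((1 - q * u * v) * B)"
    unfolding e2 B1[symmetric] by (simp add: mult_ac)
  have f5: "rogers_T q m N = (1 - q ^ Suc m) * rogers_S q (Suc m) N - A * (1 - u) * B"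
    using Suc by (simp add: A_def B_def u_def)
  show ?case
    unfolding f1 f2 f4 f5 B2 by (simp add: algebra_simps numeral_eq_Suc)
qed (simp add: rogers_S_def rogers_T_def)

lemma rogers_S_eq:
  fixes q :: "'a::idom"
  assumes "\<And>j. qfact q j \<noteq> 0"
  shows "rogers_S q m N = rogers_T q m N + q ^ Suc m * (1 - q ^ Suc m) * rogers_T q (Suc m) N -
    (-1) ^ N * q ^ (2 * m * N + 2 * N * N + N + (N choose 2)) * (1 - q ^ N) * qbinomial q (m + N) N"
proof (induction N)
  case (Suc N)
  define B A u v where "B = qbinomial q (m + N) N"
      and "A = (-1) ^ N * q ^ (2 * m * N + 2 * N * N + N + (N choose 2))"
    and "u = q ^ N" and "v = q ^ m"
  have B1: "(1 - q ^ Suc N) * qbinomial q (Suc (m + N)) (Suc N) = (1 - q * u * v) * B"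
    and B2: "(1 - q ^ Suc m) * qbinomial q (Suc (m + N)) N = (1 - q * u * v) * B"
    using qbinomial_absorb[OF assms] by (simp_all add: B_def u_def v_def power_add mult_ac)
  have e1: "(-1) ^ N * q ^ (2 * Suc m * N + 2 * N * N + 2 * N + (N choose 2)) = A * u^3"
    "(-1) ^ N * q ^ (2 * m * N + 2 * N * N + 2 * N + (N choose 2)) = A * u"
    by (simp_all add: A_def u_def algebra_simps flip: power_add power_mult)
  have "q ^ (2 * m * Suc N + 2 * Suc N * Suc N + Suc N + (Suc N choose 2)) =
      q ^ (2 * m * N + 2 * N * N + N + (N choose 2)) * v^2 * u^5 * q^3"
    unfolding u_def v_def power_mult[symmetric] power_add[symmetric]
    by (rule arg_cong[of _ _ "power q"]) (simp add: choose_two_Suc algebra_simps)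
  then have e2: "(-1) ^ Suc N * q ^ (2 * m * Suc N + 2 * Suc N * Suc N + Suc N +
      (Suc N choose 2)) = - (A * v^2 * u^5 * q^3)"
    by (simp only: A_def power_Suc) simp
  have e3: "q ^ (2 * m + 2 + 4 * N) = q^2 * v^2 * u^4" "q ^ (m + 1 + 2 * N) = q * v * u^2"
    "q ^ (Suc m + 1 + 2 * N) = q^2 * v * u^2" "q ^ Suc m = q * v"
    by (simp_all add: u_def v_def algebra_simps flip: power_add power_mult)
  have f1: "rogers_S q m (Suc N) = rogers_S q m N + A * B * (1 - q^2 * v^2 * u^4)"
    unfolding rogers_S_def sum.lessThan_Suc e3 by (simp add: A_def B_def)
  have f2: "rogers_T q m (Suc N) = rogers_T q m N + A * u * B * (1 - q * v * u^2)"
    unfolding rogers_T_def sum.lessThan_Suc e3 e1 by (simp add: B_def)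
  have f3: "q ^ Suc m * (1 - q ^ Suc m) * rogers_T q (Suc m) (Suc N) =
      q ^ Suc m * (1 - q ^ Suc m) * rogers_T q (Suc m) N +
      q * v * A * u^3 * ((1 - q ^ Suc m) * qbinomial q (Suc (m + N)) N) * (1 - q^2 * v * u^2)"
    unfolding rogers_T_def sum.lessThan_Suc e3 e1 by (simp add: algebra_simps)
  have f4: "(-1) ^ Suc N * q ^ (2 * m * Suc N + 2 * Suc N * Suc N + Suc N +
      (Suc N choose 2)) * (1 - q ^ Suc N) * qbinomial q (m + Suc N) (Suc N)
     = - (A * v^2 * u^5 * q^3) * ((1 - q * u * v) * B)"
    unfolding e2 B1[symmetric] by (simp add: mult_ac)
  have f5: "rogers_S q m N = rogers_T q m N + q ^ Suc m * (1 - q ^ Suc m) * rogers_T q (Suc m) N -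
      A * (1 - u) * B"
    using Suc by (simp add: A_def B_def u_def)
  show ?case
    unfolding f1 f2 f3 f4 f5 B2 by (simp add: algebra_simps numeral_eq_Suc)
qed (simp add: rogers_S_def rogers_T_def)

section \<open>Rogers' relations for power series, and theta series at \<open>x = 1\<close>\<close>

lemma qfact_X_nonzero: "qfact (fps_X :: 'a::idom fps) n \<noteq> 0"
proof -
  have "fps_nth (qfact (fps_X :: 'a fps) n) 0 = 1"
    by (induction n) (simp_all add: qfact_Suc fps_nth_power_0)
  then show ?thesis by auto
qed

text \<open>The remainder in \<open>rogers_T_eq\<close> contains a power of \<open>fps_X\<close>
  with exponent at least \<open>N\<close>.\<close>

lemma rogers_T_cong:
  "fps_cong N (rogers_T fps_X m N)
     ((1 - fps_X ^ Suc m) * rogers_S (fps_X :: 'a::idom fps) (Suc m) N)"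
proof -
  let ?e = "2 * m * N + 2 * N * N + 2 * N + (N choose 2)"
  have "fps_cong N (fps_X ^ ?e * ((-1) ^ N * (1 - fps_X ^ N) * qbinomial fps_X (m + N) N))
      (0 :: 'a fps)"
    by (intro fps_cong_X_power_mult) simp
  then show ?thesis
    by (auto simp: rogers_T_eq[OF qfact_X_nonzero] mult_ac dest: fps_cong_diff[OF fps_cong_refl])
qed

lemma rogers_S_cong:
  "fps_cong N (rogers_S fps_X m N)
     (rogers_T (fps_X :: 'a::idom fps) m N +
         fps_X ^ Suc m * (1 - fps_X ^ Suc m) * rogers_T fps_X (Suc m) N)"
proof -
  let ?e = "2 * m * N + 2 * N * N + N + (N choose 2)"
  have "fps_cong N (fps_X ^ ?e * ((-1) ^ N * (1 - fps_X ^ N) * qbinomial fps_X (m + N) N))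
      (0 :: 'a fps)"
    by (intro fps_cong_X_power_mult) simp
  then show ?thesis
    by (auto simp: rogers_S_eq[OF qfact_X_nonzero] mult_ac dest: fps_cong_diff[OF fps_cong_refl])
qed

text \<open>Initial values for the recursion: the terms with \<open>n > 0\<close> and the subtracted
  power in the term \<open>n = 0\<close> have exponents above \<open>m\<close>.\<close>

lemma rogers_cong_1:
  assumes "N > 0"
  shows "fps_cong (Suc m) (rogers_S fps_X m N) (1 :: 'a::idom fps)"
    and "fps_cong (Suc m) (rogers_T fps_X m N) (1 :: 'a::idom fps)"
proof -
  obtain N' where N: "N = Suc N'" using assms gr0_implies_Suc by blast
  have *: "fps_cong (Suc m) (\<Sum>n<N. (-1) ^ n * fps_X ^ e n * f n * (1 - fps_X ^ d n)) (1 :: 'a fps)"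
    if "e 0 = 0" "f 0 = 1" "d 0 \<ge> Suc m" "\<And>n. e (Suc n) \<ge> Suc m" for e d :: "nat \<Rightarrow> nat" and f
  proof -
    have "fps_cong (Suc m) ((1 - fps_X ^ d 0 * 1) +
        (\<Sum>n<N'. fps_X ^ e (Suc n) * ((-1) ^ Suc n * f (Suc n) * (1 - fps_X ^ d (Suc n)))))
       ((1 - 0) + (\<Sum>n<N'. 0 :: 'a fps))"
      using that by (intro fps_cong_add fps_cong_diff fps_cong_sum fps_cong_X_power_mult
          fps_cong_refl)
    then show ?thesis
      unfolding N by (subst sum.lessThan_Suc_shift) (simp add: that mult_ac)
  qed
  show "fps_cong (Suc m) (rogers_S fps_X m N) (1 :: 'a::idom fps)"
    unfolding rogers_S_def by (rule *) (auto simp: binomial_eq_0)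
  show "fps_cong (Suc m) (rogers_T fps_X m N) (1 :: 'a::idom fps)"
    unfolding rogers_T_def by (rule *) (auto simp: binomial_eq_0)
qed

text \<open>At \<open>m = 0\<close> the Gaussian binomials are \<open>qbinomial q n n = 1\<close>,
  which leaves the theta series of the triple product with \<open>a = 3\<close>,
  \<open>b = 2\<close>.\<close>

lemma rogers_S_0_cong:
  "fps_cong M (rogers_S fps_X 0 (Suc (2 * M)))
     (\<Prod>m<2 * M. (1 - fps_X ^ (5 * m + 3)) * (1 - fps_X ^ (5 * m + 2)) *
                 (1 - fps_X ^ (5 * m + 5)) :: 'a::idom fps)"
proof -
  have e: "5 * (n choose 2) + 3 * n = 2 * n * n + n + (n choose 2)"
    "5 * (Suc n choose 2) + 2 * Suc n = 2 * n * n + n + (n choose 2) + (2 + 4 * n)" for n :: nat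
    using choose_two_double[of n] by (simp_all add: choose_two_Suc)
  have "rogers_S fps_X 0 (Suc (2 * M)) =
      (\<Sum>n\<le>2 * M. (-1) ^ n * (fps_X ^ (5 * (n choose 2) + 3 * n) -
         fps_X ^ (5 * (Suc n choose 2) + 2 * Suc n)) :: 'a fps)"
    unfolding rogers_S_def lessThan_Suc_atMost e power_add[of _ _ "2 + 4 * _"]
    by (intro sum.cong refl) (simp add: algebra_simps)
  with fps_cong_sym[OF jacobi_triple_product_cong[of 3 2 M, where 'a='a]] show ?thesis
    by simp
qed

text \<open>The same specialisation, now with \<open>a = 4\<close>, \<open>b = 1\<close>.\<close>

lemma rogers_T_0_cong:
  "fps_cong M (rogers_T fps_X 0 (Suc (2 * M)))
     (\<Prod>m<2 * M. (1 - fps_X ^ (5 * m + 4)) * (1 - fps_X ^ (5 * m + 1)) *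
                 (1 - fps_X ^ (5 * m + 5)) :: 'a::idom fps)"
proof -
  have e: "5 * (n choose 2) + 4 * n = 2 * n * n + 2 * n + (n choose 2)"
    "5 * (Suc n choose 2) + 1 * Suc n = 2 * n * n + 2 * n + (n choose 2) + (1 + 2 * n)" for n :: nat
    using choose_two_double[of n] by (simp_all add: choose_two_Suc)
  have "rogers_T fps_X 0 (Suc (2 * M)) =
      (\<Sum>n\<le>2 * M. (-1) ^ n * (fps_X ^ (5 * (n choose 2) + 4 * n) -
         fps_X ^ (5 * (Suc n choose 2) + 1 * Suc n)) :: 'a fps)"
    unfolding rogers_T_def lessThan_Suc_atMost e power_add[of _ _ "1 + 2 * _"]
    by (intro sum.cong refl) (simp add: algebra_simps)
  with fps_cong_sym[OF jacobi_triple_product_cong[of 4 1 M, where 'a='a]] show ?thesis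
    by simp
qed

section \<open>The generating function of edge sets\<close>

primrec vlabel :: "vertex \<Rightarrow> nat" where
  "vlabel (X h) = h"
| "vlabel (Y h) = h"

abbreviation weight :: "vertex set \<Rightarrow> nat" where
  "weight U \<equiv> sum vlabel U"

text \<open>Each edge is filed under its lower label \<open>h\<close>, so that raising
  \<open>k\<close> by one removes just two edges; \<open>d\<close> truncates the range of
  \<open>h\<close>.\<close>

definition edge_pool :: "nat \<Rightarrow> nat \<Rightarrow> vertex set set" where
  "edge_pool k d = (\<Union>h\<in>{k..<k + d}. {{X (h + 1), X h}, {X h, Y h}})"

lemma finite_edge_pool [simp]: "finite (edge_pool k d)"
  by (simp add: edge_pool_def)

lemma edge_pool_0 [simp]: "edge_pool k 0 = {}"
  by (simp add: edge_pool_def)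

lemma edge_pool_Suc:
  "edge_pool k (Suc d) = insert {X (k + 1), X k} (insert {X k, Y k} (edge_pool (Suc k) d))"
proof -
  have "{k..<k + Suc d} = insert k {Suc k..<Suc k + d}"
    by auto
  then show ?thesis
    unfolding edge_pool_def by simp
qed

lemma finite_Union_subset_edge_pool: "E \<subseteq> edge_pool k d \<Longrightarrow> finite (\<Union>E)"
  using finite_subset[OF _ finite_edge_pool] by (auto simp: edge_pool_def)

lemma vlabel_edge_pool: "E \<subseteq> edge_pool k d \<Longrightarrow> v \<in> \<Union>E \<Longrightarrow> k \<le> vlabel v"
  by (fastforce simp: edge_pool_def)

lemma sum_Pow_insert:
  assumes "finite A" "a \<notin> A"
  shows "(\<Sum>E\<in>Pow (insert a A). f E) = (\<Sum>E\<in>Pow A. f E + f (insert a E))"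
proof -
  have "inj_on (insert a) (Pow A)"
    using assms(2) by (auto simp: inj_on_def)
  moreover have "Pow A \<inter> insert a ` Pow A = {}"
    using assms(2) by auto
  ultimately show ?thesis
    using assms(1) by (simp add: Pow_insert sum.union_disjoint sum.reindex sum.distrib)
qed

definition cover_gf :: "nat \<Rightarrow> nat \<Rightarrow> int fps" where
  "cover_gf d k = (\<Sum>E\<in>Pow (edge_pool k d). (-1) ^ card E * fps_X ^ weight (\<Union>E))"

text \<open>Here \<open>X k\<close> counts as already covered by an edge below the pool, so it carries no weight.\<close>

definition precover_gf :: "nat \<Rightarrow> nat \<Rightarrow> int fps" where
  "precover_gf d k = (\<Sum>E\<in>Pow (edge_pool k d). (-1) ^ card E * fps_X ^ weight (\<Union>E - {X k}))"

text \<open>Each of the two edges filed under \<open>k\<close> is present or absent, giving four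
  cases with signs +, -, -, +. A general \<open>f\<close> of the covered set serves both generating
  functions.\<close>

lemma sum_Pow_edge_pool_Suc:
  "(\<Sum>E\<in>Pow (edge_pool k (Suc d)). (-1) ^ card E * f (\<Union>E)) =
   (\<Sum>E\<in>Pow (edge_pool (Suc k) d). (-1) ^ card E *
      (f (\<Union>E) - f (insert (X k) (insert (Y k) (\<Union>E))) -
       (f (insert (X (Suc k)) (insert (X k) (\<Union>E))) -
        f (insert (X (Suc k)) (insert (X k) (insert (Y k) (\<Union>E)))))) :: int fps)"
proof -
  let ?e = "{X (k + 1), X k}" and ?f = "{X k, Y k}" and ?A = "edge_pool (Suc k) d"
  \<comment> \<open>No edge of the higher pool meets \<open>X k\<close>, so neither of the two
    lowest edges lies in it.\<close>
  have nf: "?f \<notin> ?A"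
    using vlabel_edge_pool[of "edge_pool (Suc k) d" "Suc k" d "X k"] by auto
  have ne: "?e \<notin> insert ?f ?A"
    using vlabel_edge_pool[of "edge_pool (Suc k) d" "Suc k" d "X k"]
      by (auto simp: doubleton_eq_iff)
  have "(\<Sum>E\<in>Pow (edge_pool k (Suc d)). (-1) ^ card E * f (\<Union>E)) =
     (\<Sum>E\<in>Pow ?A. (-1) ^ card E * f (\<Union>E) + (-1) ^ card (insert ?e E) * f (\<Union>(insert ?e E)) +
       ((-1) ^ card (insert ?f E) * f (\<Union>(insert ?f E)) +
        (-1) ^ card (insert ?e (insert ?f E)) * f (\<Union>(insert ?e (insert ?f E)))))"
    unfolding edge_pool_Suc using nf ne by (simp only: sum_Pow_insert finite_edge_pool
        finite_insert not_False_eq_True)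
  also have "\<dots> = (\<Sum>E\<in>Pow ?A. (-1) ^ card E *
      (f (\<Union>E) - f (insert (X k) (insert (Y k) (\<Union>E))) -
       (f (insert (X (Suc k)) (insert (X k) (\<Union>E))) -
        f (insert (X (Suc k)) (insert (X k) (insert (Y k) (\<Union>E)))))))"
  proof (rule sum.cong)
    fix E assume E: "E \<in> Pow ?A"
    then have "finite E" by (auto intro: finite_subset[OF _ finite_edge_pool])
    moreover have "?f \<notin> E" "?e \<notin> E" "?e \<notin> insert ?f E"
      using nf ne E by auto
    ultimately have "card (insert ?e E) = Suc (card E)" "card (insert ?f E) = Suc (card E)"
      "card (insert ?e (insert ?f E)) = Suc (Suc (card E))"
      by simp_all
    moreover have "\<Union>(insert ?e E) = insert (X (Suc k)) (insert (X k) (\<Union>E))"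
      "\<Union>(insert ?f E) = insert (X k) (insert (Y k) (\<Union>E))"
      "\<Union>(insert ?e (insert ?f E)) = insert (X (Suc k)) (insert (X k) (insert (Y k) (\<Union>E)))"
      by auto
    ultimately show "(-1) ^ card E * f (\<Union>E) + (-1) ^ card (insert ?e E) * f (\<Union>(insert ?e E)) +
       ((-1) ^ card (insert ?f E) * f (\<Union>(insert ?f E)) +
        (-1) ^ card (insert ?e (insert ?f E)) * f (\<Union>(insert ?e (insert ?f E)))) =
       (-1) ^ card E *
      (f (\<Union>E) - f (insert (X k) (insert (Y k) (\<Union>E))) -
       (f (insert (X (Suc k)) (insert (X k) (\<Union>E))) -
        f (insert (X (Suc k)) (insert (X k) (insert (Y k) (\<Union>E))))))"
      by (simp add: algebra_simps del: Union_insert)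
  qed simp
  finally show ?thesis .
qed

text \<open>If the edge from \<open>X k\<close> to \<open>X (Suc k)\<close> is chosen, the label of
  \<open>X (Suc k)\<close> is paid for at once and the remaining edges are counted by
  \<open>precover_gf\<close>; otherwise they are counted by \<open>cover_gf\<close>.\<close>

lemma cover_gf_Suc:
  "cover_gf (Suc d) k = (1 - fps_X ^ (2 * k)) * cover_gf d (Suc k) -
     fps_X ^ (2 * k + 1) * (1 - fps_X ^ k) * precover_gf d (Suc k)"
  and precover_gf_Suc:
  "precover_gf (Suc d) k = (1 - fps_X ^ k) * (cover_gf d (Suc k) - fps_X ^ (k +
      1) * precover_gf d (Suc k))"
proof -
  let ?A = "edge_pool (Suc k) d"
  have w: "finite (\<Union>E)" "X k \<notin> \<Union>E" "Y k \<notin> \<Union>E" if "E \<in> Pow ?A" for E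
    using that finite_Union_subset_edge_pool[of E] vlabel_edge_pool[of E "Suc k" d "X k"]
      vlabel_edge_pool[of E "Suc k" d "Y k"] by auto
  have "cover_gf (Suc d) k = (\<Sum>E\<in>Pow ?A. (-1) ^ card E *
      ((1 - fps_X ^ (2 * k)) * fps_X ^ weight (\<Union>E) -
       fps_X ^ (2 * k + 1) * (1 - fps_X ^ k) * fps_X ^ weight (\<Union>E - {X (Suc k)})))"
    unfolding cover_gf_def sum_Pow_edge_pool_Suc[where f="\<lambda>U. fps_X ^ weight U"]
  proof (intro sum.cong arg_cong2[of _ _ _ _ "(*)"] refl)
    fix E assume E: "E \<in> Pow ?A"
    \<comment> \<open>\<open>X (Suc k)\<close> may already be covered by \<open>E\<close>; removing
      it first makes the weight after inserting it the same in both cases.\<close>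
    define r where "r = weight (\<Union>E - {X (Suc k)})"
    have "weight (insert (X k) (insert (Y k) (\<Union>E))) = 2 * k + weight (\<Union>E)"
      "weight (insert (X (Suc k)) (insert (X k) (\<Union>E))) = 2 * k + 1 + r"
      "weight (insert (X (Suc k)) (insert (X k) (insert (Y k) (\<Union>E)))) = 2 * k + 1 + k + r"
      using w[OF E] unfolding r_def by (simp_all add: sum.insert_remove insert_Diff_if)
    then show "fps_X ^ weight (\<Union>E) - fps_X ^ weight (insert (X k) (insert (Y k) (\<Union>E))) -
        (fps_X ^ weight (insert (X (Suc k)) (insert (X k) (\<Union>E))) -
         fps_X ^ weight (insert (X (Suc k)) (insert (X k) (insert (Y k) (\<Union>E))))) =
        (1 - fps_X ^ (2 * k)) * fps_X ^ weight (\<Union>E) -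
        fps_X ^ (2 * k + 1) * (1 - fps_X ^ k) * (fps_X :: int fps) ^ weight (\<Union>E - {X (Suc k)})"
      unfolding r_def[symmetric] by (simp only: power_add) (simp add: algebra_simps)
  qed
  also have "\<dots> = (1 - fps_X ^ (2 * k)) * cover_gf d (Suc k) -
     fps_X ^ (2 * k + 1) * (1 - fps_X ^ k) * precover_gf d (Suc k)"
    unfolding cover_gf_def precover_gf_def sum_distrib_left sum_subtractf[symmetric]
    by (intro sum.cong refl) (simp only: right_diff_distrib mult.left_commute)
  finally show "cover_gf (Suc d) k = (1 - fps_X ^ (2 * k)) * cover_gf d (Suc k) -
     fps_X ^ (2 * k + 1) * (1 - fps_X ^ k) * precover_gf d (Suc k)" .
  have "precover_gf (Suc d) k = (\<Sum>E\<in>Pow ?A. (-1) ^ card E *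
      ((1 - fps_X ^ k) * (fps_X ^ weight (\<Union>E) -
       fps_X ^ (k + 1) * fps_X ^ weight (\<Union>E - {X (Suc k)}))))"
    unfolding precover_gf_def sum_Pow_edge_pool_Suc[where f="\<lambda>U. fps_X ^ weight (U - {X k})"]
  proof (intro sum.cong arg_cong2[of _ _ _ _ "(*)"] refl)
    fix E assume E: "E \<in> Pow ?A"
    define r where "r = weight (\<Union>E - {X (Suc k)})"
    have "\<Union>E - {X k} = \<Union>E"
      "insert (X k) (insert (Y k) (\<Union>E)) - {X k} = insert (Y k) (\<Union>E)"
      "insert (X (Suc k)) (insert (X k) (\<Union>E)) - {X k} = insert (X (Suc k)) (\<Union>E)"
      "insert (X (Suc k)) (insert (X k) (insert (Y k) (\<Union>E))) - {X k} =
          insert (X (Suc k)) (insert (Y k) (\<Union>E))"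
      using w[OF E] by auto
    moreover have "weight (insert (Y k) (\<Union>E)) = k + weight (\<Union>E)"
      "weight (insert (X (Suc k)) (\<Union>E)) = k + 1 + r"
      "weight (insert (X (Suc k)) (insert (Y k) (\<Union>E))) = k + (k + 1) + r"
      using w[OF E] unfolding r_def by (simp_all add: sum.insert_remove insert_Diff_if)
    ultimately show "fps_X ^ weight (\<Union>E - {X k}) -
        fps_X ^ weight (insert (X k) (insert (Y k) (\<Union>E)) - {X k}) -
        (fps_X ^ weight (insert (X (Suc k)) (insert (X k) (\<Union>E)) - {X k}) -
         fps_X ^ weight (insert (X (Suc k)) (insert (X k) (insert (Y k) (\<Union>E))) - {X k})) =
        (1 - fps_X ^ k) * (fps_X ^ weight (\<Union>E) -
        fps_X ^ (k + 1) * (fps_X :: int fps) ^ weight (\<Union>E - {X (Suc k)}))"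
      unfolding r_def[symmetric] by (simp only: power_add) (simp add: algebra_simps)
  qed
  also have "\<dots> = (1 - fps_X ^ k) * (cover_gf d (Suc k) - fps_X ^ (k + 1) * precover_gf d (Suc k))"
    unfolding cover_gf_def precover_gf_def sum_distrib_left sum_subtractf[symmetric]
    by (intro sum.cong refl) (simp only: right_diff_distrib mult.left_commute)
  finally show "precover_gf (Suc d) k = (1 - fps_X ^ k) * (cover_gf d (Suc k) - fps_X ^ (k +
      1) * precover_gf d (Suc k))" .
qed

text \<open>Both pairs satisfy the same recursion. It is run from the empty pool, where both
  generating functions are 1, and the smallest label \<open>Suc k\<close> corresponds to
  \<open>x = q ^ k\<close>.\<close>

lemma cover_gf_cong_rogers:
  assumes "Suc k + d \<le> N"
  shows "fps_cong (Suc k + d) (cover_gf d (Suc k)) (rogers_S fps_X k N) \<and>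
    fps_cong (Suc k + d) (precover_gf d (Suc k)) ((1 - fps_X ^ Suc k) * rogers_T fps_X (Suc k) N)"
  using assms
proof (induction d arbitrary: k)
  case 0
  then have "N > 0" by simp
  from rogers_cong_1(1)[OF this, of k] have "fps_cong (Suc k) (rogers_S fps_X k N) (1 :: int fps)" .
  moreover have "fps_cong (Suc k) (rogers_T fps_X (Suc k) N) (1 :: int fps)"
    by (rule fps_cong_mono[OF rogers_cong_1(2)[OF \<open>N > 0\<close>]]) simp
  then have "fps_cong (Suc k) ((1 - fps_X ^ Suc k * 1) * rogers_T fps_X (Suc k) N) ((1 -
      0) * (1 :: int fps))"
    by (intro fps_cong_mult fps_cong_diff fps_cong_X_power_mult fps_cong_refl) auto
  ultimately show ?case
    by (simp add: cover_gf_def precover_gf_def fps_cong_sym)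
next
  case (Suc d)
  \<comment> \<open>The modulus is the same for the pair \<open>Suc d\<close>, \<open>k\<close> as
    for \<open>d\<close>, \<open>Suc k\<close>, so the induction hypothesis loses no
    precision.\<close>
  define M where "M = Suc k + Suc d"
  define u :: "int fps" where "u = fps_X ^ Suc k"
  define S0 S1 T0 T1 T2 :: "int fps" where "S0 = rogers_S fps_X k N"
      and "S1 = rogers_S fps_X (Suc k) N"
    and "T0 = rogers_T fps_X k N" and "T1 = rogers_T fps_X (Suc k) N"
        and "T2 = rogers_T fps_X (Suc (Suc k)) N"
  have MN: "M \<le> N" using Suc.prems by (simp add: M_def)
  have IH: "fps_cong M (cover_gf d (Suc (Suc k))) S1"
    "fps_cong M (precover_gf d (Suc (Suc k))) ((1 - u * fps_X) * T2)"
    using Suc.IH[of "Suc k"] Suc.prems by (simp_all add: M_def S1_def T2_def u_def mult_ac)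
  have S0: "fps_cong M S0 (T0 + u * (1 - u) * T1)"
    using fps_cong_mono[OF rogers_S_cong MN, of k] by (simp add: S0_def T0_def T1_def u_def mult_ac)
  have T0: "fps_cong M T0 ((1 - u) * S1)"
    using fps_cong_mono[OF rogers_T_cong MN, of k] by (simp add: S1_def T0_def u_def mult_ac)
  have "fps_cong M S1 (T1 + u * fps_X * (1 - u * fps_X) * T2)"
    using fps_cong_mono[OF rogers_S_cong MN, of "Suc k"]
      by (simp add: S1_def T1_def T2_def u_def mult_ac)
  from fps_cong_diff[OF this fps_cong_refl[of _ "u * fps_X * (1 - u * fps_X) * T2"]]
  have T1: "fps_cong M (S1 - u * fps_X * (1 - u * fps_X) * T2) T1"
    by simp
  have "cover_gf (Suc d) (Suc k) = (1 - u * u) * cover_gf d (Suc (Suc k)) -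
      u * u * fps_X * (1 - u) * precover_gf d (Suc (Suc k))"
    unfolding cover_gf_Suc u_def by (simp only: mult_2 power_add power_one_right)
  also have "fps_cong M \<dots> ((1 - u * u) * S1 - u * u * fps_X * (1 - u) * ((1 - u * fps_X) * T2))"
    by (intro fps_cong_diff fps_cong_mult fps_cong_refl IH)
  \<comment> \<open>Splitting \<open>1 - u * u\<close> as \<open>(1 - u) + u * (1 - u)\<close>
    isolates \<open>T0\<close> in the first summand and, together with the \<open>T2\<close> term,
    \<open>T1\<close> in the second.\<close>
  also have "\<dots> = (1 - u) * S1 + u * (1 - u) * (S1 - u * fps_X * (1 - u * fps_X) * T2)"
    by (simp add: algebra_simps)
  also have "fps_cong M \<dots> (T0 + u * (1 - u) * T1)"
    by (intro fps_cong_add fps_cong_mult fps_cong_refl T1 fps_cong_sym[OF T0])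
  also have "fps_cong M \<dots> S0"
    by (rule fps_cong_sym[OF S0])
  finally have c: "fps_cong M (cover_gf (Suc d) (Suc k)) S0" .
  have "precover_gf (Suc d) (Suc k) = (1 - u) * (cover_gf d (Suc (Suc k)) -
      u * fps_X * precover_gf d (Suc (Suc k)))"
    unfolding precover_gf_Suc u_def by (simp add: mult_ac)
  also have "fps_cong M \<dots> ((1 - u) * (S1 - u * fps_X * ((1 - u * fps_X) * T2)))"
    by (intro fps_cong_diff fps_cong_mult fps_cong_refl IH)
  also have "\<dots> = (1 - u) * (S1 - u * fps_X * (1 - u * fps_X) * T2)"
    by (simp add: mult_ac)
  also have "fps_cong M \<dots> ((1 - u) * T1)"
    by (intro fps_cong_mult fps_cong_refl T1)
  finally show ?case
    using c by (simp only: M_def S0_def T1_def u_def)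
qed

lemma fps_nth_minus_one_power_mult:
  "fps_nth ((-1) ^ k * f) n = (-1) ^ k * fps_nth (f :: 'a::comm_ring_1 fps) n"
  by (cases "even k") auto

section \<open>Neighborly partitions as vertex covers\<close>

definition all_edges :: "vertex set set" where
  "all_edges = range (\<lambda>h. {X (h + 1), X h}) \<union> range (\<lambda>h. {X h, Y h})"

lemma edge_pool_subset_all_edges: "edge_pool k d \<subseteq> all_edges"
  by (auto simp: edge_pool_def all_edges_def)

text \<open>A spanning \<open>H\<close> is determined by its edges, and having no isolated vertices
  means that they cover everything. Conversely, a member of \<open>all_edges\<close> with both ends
  in \<open>partition_verts xs\<close> is an edge of the graph.\<close>

lemma signature_eq:
  "signature xs = (\<Sum>E | E \<subseteq> all_edges \<and> \<Union>E = partition_verts xs. (-1) ^ card E)"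
  unfolding signature_def
proof (rule sum.reindex_bij_witness[where j = edges and i = "\<lambda>E. \<lparr>verts =
    partition_verts xs, edges = E\<rparr>"])
  fix H :: "vertex sgraph"
  assume H: "H \<in> {H. subgraph H (partition_graph xs) \<and> verts H =
      verts (partition_graph xs) \<and> no_isolated H}"
  then have V: "verts H = partition_verts xs"
    by (simp add: partition_graph_def)
  then show "\<lparr>verts = partition_verts xs, edges = edges H\<rparr> = H"
    by simp
  have "edges H \<subseteq> all_edges"
    using H by (auto simp: subgraph_def partition_graph_def all_edges_def)
  moreover have "\<Union>(edges H) = partition_verts xs"
    using H V by (auto simp: subgraph_def simple_graph_def no_isolated_def)
  ultimately show "edges H \<in> {E. E \<subseteq> all_edges \<and> \<Union>E = partition_verts xs}"
    by simp
next
  fix E assume E: "E \<in> {E. E \<subseteq> all_edges \<and> \<Union>E = partition_verts xs}"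
  have "e \<in> edges (partition_graph xs)" if "e \<in> E" for e
  proof -
    have "e \<subseteq> partition_verts xs" "e \<in> all_edges"
      using E that by auto
    then show ?thesis
      by (auto simp: all_edges_def partition_graph_def)
  qed
  moreover have "card e = 2" if "e \<in> E" for e
    using E that by (auto simp: all_edges_def)
  ultimately show "\<lparr>verts = partition_verts xs, edges = E\<rparr> \<in>
      {H. subgraph H (partition_graph xs) \<and> verts H = verts (partition_graph xs) \<and> no_isolated H}"
    using E by (auto simp: subgraph_def simple_graph_def no_isolated_def partition_graph_def)
qed auto

lemma count_image_vlabel:
  assumes "finite U" and "\<And>h. Y h \<in> U \<Longrightarrow> X h \<in> U"
  shows "count (image_mset vlabel (mset_set U)) h =
    (if Y h \<in> U then 2 else if X h \<in> U then 1 else 0)"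
proof -
  have "count (image_mset vlabel (mset_set U)) h = card (vlabel -` {h} \<inter> U)"
    using assms(1) by (simp add: count_image_mset)
  also have "vlabel -` {h} \<inter> U = {v \<in> {X h, Y h}. v \<in> U}"
  proof (intro equalityI subsetI)
    fix v assume "v \<in> vlabel -` {h} \<inter> U"
    then show "v \<in> {v \<in> {X h, Y h}. v \<in> U}" by (cases v) auto
  qed auto
  also have "\<dots> = (if Y h \<in> U then {X h, Y h} else if X h \<in> U then {X h} else {})"
    using assms(2)[of h] by auto
  finally show ?thesis by auto
qed

lemma mset_eq_image_partition_verts:
  assumes "\<forall>h. count_list xs h \<le> 2"
  shows "mset xs = image_mset vlabel (mset_set (partition_verts xs))"
proof (rule multiset_eqI)
  fix h
  have *: "X h \<in> partition_verts xs \<longleftrightarrow> count_list xs h \<noteq> 0"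
      "Y h \<in> partition_verts xs \<longleftrightarrow> count_list xs h = 2" for h
    by (auto simp: partition_verts_def count_list_0_iff)
  have "count (image_mset vlabel (mset_set (partition_verts xs))) h =
    (if count_list xs h = 2 then 2 else if count_list xs h \<noteq> 0 then 1 else 0)"
    by (subst count_image_vlabel) (simp_all add: * finite_partition_verts)
  also have "\<dots> = count_list xs h"
    using assms[rule_format, of h] by auto
  finally show "count (mset xs) h = count (image_mset vlabel (mset_set (partition_verts xs))) h"
    by (simp add: count_mset)
qed

text \<open>The inverse of \<open>partition_verts\<close>, on vertex sets that contain
  \<open>X h\<close> whenever they contain \<open>Y h\<close>.\<close>

definition cover_parts :: "vertex set \<Rightarrow> nat list" where
  "cover_parts U = rev (sorted_list_of_multiset (image_mset vlabel (mset_set U)))"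

lemma mset_cover_parts [simp]: "mset (cover_parts U) = image_mset vlabel (mset_set U)"
  by (simp add: cover_parts_def)

lemma sorted_cover_parts: "sorted_wrt (\<ge>) (cover_parts U)"
  by (simp add: cover_parts_def sorted_wrt_rev)

lemma sorted_wrt_ge_mset_unique:
  fixes xs ys :: "nat list"
  assumes "sorted_wrt (\<ge>) xs" "sorted_wrt (\<ge>) ys" "mset xs = mset ys"
  shows "xs = ys"
proof -
  have "rev xs = sort (rev ys)" "sort (rev ys) = rev ys"
    using assms by (auto intro!: properties_for_sort[symmetric] sorted_sort_id simp: sorted_wrt_rev)
  then show ?thesis by simp
qed

lemma sum_list_cover_parts: "sum_list (cover_parts U) = weight U"
  by (simp add: sum_mset_sum_list[symmetric] sum_unfold_sum_mset)

lemma set_cover_parts: "finite U \<Longrightarrow> set (cover_parts U) = vlabel ` U"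
  by (simp flip: set_mset_mset)

lemma cover_parts_partition_verts:
  assumes "\<forall>h. count_list xs h \<le> 2" "sorted_wrt (\<ge>) xs"
  shows "cover_parts (partition_verts xs) = xs"
  using assms by (intro sorted_wrt_ge_mset_unique sorted_cover_parts)
      (simp_all add: mset_eq_image_partition_verts)

lemma count_list_cover_parts:
  assumes "finite U" and "\<And>h. Y h \<in> U \<Longrightarrow> X h \<in> U"
  shows "count_list (cover_parts U) h = (if Y h \<in> U then 2 else if X h \<in> U then 1 else 0)"
  using count_image_vlabel[OF assms] by (simp flip: count_mset)

lemma partition_verts_cover_parts:
  assumes "finite U" and Y: "\<And>h. Y h \<in> U \<Longrightarrow> X h \<in> U"
  shows "partition_verts (cover_parts U) = U"
proof -
  have *: "X h \<in> partition_verts (cover_parts U) \<longleftrightarrow> X h \<in> U"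
    "Y h \<in> partition_verts (cover_parts U) \<longleftrightarrow> Y h \<in> U" for h
    using Y[of h] count_list_0_iff[of "cover_parts U" h]
    by (auto simp: partition_verts_def count_list_cover_parts[OF assms] split: if_splits)
  show ?thesis
  proof (rule set_eqI)
    fix v show "v \<in> partition_verts (cover_parts U) \<longleftrightarrow> v \<in> U"
      by (cases v) (simp_all add: *)
  qed
qed

text \<open>For a part \<open>h\<close>, some edge of \<open>E\<close> covers \<open>X h\<close>;
  its other end supplies the neighbour, which is \<open>h + 1\<close>, \<open>h - 1\<close> or a
  second copy of \<open>h\<close>.\<close>

lemma cover_parts_neighborly:
  assumes E: "E \<subseteq> edge_pool (3 - i) d" and i: "i \<in> {1, 2}"
  shows "cover_parts (\<Union>E) \<in> neighborly i (weight (\<Union>E))"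
proof -
  let ?U = "\<Union>E" and ?xs = "cover_parts (\<Union>E)"
  have E': "E \<subseteq> all_edges"
    using E edge_pool_subset_all_edges by blast
  have fin: "finite ?U"
    using E by (rule finite_Union_subset_edge_pool)
  have Y: "X h \<in> ?U" if "Y h \<in> ?U" for h
    using that E' by (auto simp: all_edges_def)
  have ge: "x \<ge> 3 - i" if "x \<in> set ?xs" for x
    using that vlabel_edge_pool[OF E] by (auto simp: set_cover_parts[OF fin])
  moreover have "3 - i > 0" using i by auto
  ultimately have pos: "x > 0" if "x \<in> set ?xs" for x
    using that by (metis less_le_trans)
  have neigh: "\<exists>l<length ?xs. l \<noteq> j \<and> \<bar>int (?xs ! l) - int (?xs ! j)\<bar> \<le> 1" if "j < length ?xs" for j
  proof -
    define h where "h = ?xs ! j"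
    have "h \<in> vlabel ` ?U"
      using that by (simp add: h_def flip: set_cover_parts[OF fin])
    then obtain v where "v \<in> ?U" "vlabel v = h"
      by blast
    then have "X h \<in> ?U"
      using Y by (cases v) auto
    then obtain e where e: "e \<in> E" "X h \<in> e" by blast
    have other: ?thesis if "X h' \<in> ?U" "h' \<noteq> h" "\<bar>int h' - int h\<bar> \<le> 1" for h'
    proof -
      have "h' \<in> set ?xs"
        using that(1) by (force simp: set_cover_parts[OF fin])
      then obtain l where "l < length ?xs" "?xs ! l = h'"
        by (auto simp: in_set_conv_nth)
      with that show ?thesis by (intro exI[of _ l]) (auto simp: h_def)
    qed
    from e E' consider "e = {X (h + 1), X h}" | h' where "h = Suc h'" "e = {X (h' + 1), X h'}"
        | "e = {X h, Y h}"
      by (fastforce simp: all_edges_def)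
    then show ?thesis
    proof cases
      case 1
      then show ?thesis using e by (intro other[of "h + 1"]) auto
    next
      case 2
      then show ?thesis using e by (intro other[of h']) auto
    next
      case 3
      then have "Y h \<in> ?U" using e by auto
      \<comment> \<open>Multiplicity 2 gives two positions with value \<open>h\<close>, at least one
        of them different from \<open>j\<close>.\<close>
      then have "card {l. l < length ?xs \<and> h = ?xs ! l} = 2"
        using count_list_cover_parts[OF fin Y, of h]
        by (simp add: count_list_eq_length_filter length_filter_conv_card)
      then obtain l where "l \<in> {l. l < length ?xs \<and> h = ?xs ! l}" "l \<noteq> j"
        by (metis (no_types, lifting) card_2_iff insertCI)
      then show ?thesis by (intro exI[of _ l]) (auto simp: h_def)
    qed
  qed
  have "count_list ?xs h \<le> 2" for h
    using count_list_cover_parts[OF fin Y] by simp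
  with neigh ge pos show ?thesis
    by (simp add: neighborly_def partitions_of_def sorted_cover_parts sum_list_cover_parts)
qed

text \<open>After \<open>signature_eq\<close> the sum runs over pairs of a partition and an edge set
  covering its vertices; the edge set determines the partition, so only edge sets of weight
  \<open>n\<close> remain.\<close>

lemma sum_signature_eq_cover_gf:
  assumes i: "i \<in> {1, 2}" and n: "n < 3 - i + d"
  shows "(\<Sum>xs\<in>neighborly i n. signature xs) = fps_nth (cover_gf d (3 - i)) n"
proof -
  let ?C = "\<lambda>xs. {E. E \<subseteq> all_edges \<and> \<Union>E = partition_verts xs}"
  have sub: "E \<subseteq> edge_pool (3 - i) d" "weight (\<Union>E) = n" "cover_parts (\<Union>E) = xs"
    if "xs \<in> neighborly i n" "E \<in> ?C xs" for xs E
  proof -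
    have U: "\<Union>E = partition_verts xs" and E: "E \<subseteq> all_edges" using that by auto
    have bd: "3 - i \<le> h \<and> h \<le> n" if "X h \<in> \<Union>E" for h
      using \<open>xs \<in> _\<close> that member_le_sum_list[of h xs] unfolding U
      by (auto simp: neighborly_def partitions_of_def partition_verts_def)
    show "E \<subseteq> edge_pool (3 - i) d"
    proof
      fix e assume "e \<in> E"
      with E consider h where "e = {X (h + 1), X h}" | h where "e = {X h, Y h}"
        by (auto simp: all_edges_def)
      then obtain h where "X h \<in> e" "e \<in> {{X (h + 1), X h}, {X h, Y h}}"
        by cases auto
      \<comment> \<open>Labels of covered vertices are parts and hence at most \<open>n\<close>; the
        bound on \<open>n\<close> places the edge in the truncated pool.\<close>
      moreover have "h \<in> {3 - i..<3 - i + d}"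
        using bd[OF UnionI, OF \<open>e \<in> E\<close> \<open>X h \<in> e\<close>] n by auto
      ultimately show "e \<in> edge_pool (3 - i) d"
        unfolding edge_pool_def by blast
    qed
    show "cover_parts (\<Union>E) = xs"
      unfolding U using that(1) by (intro cover_parts_partition_verts)
          (auto simp: neighborly_def partitions_of_def)
    then show "weight (\<Union>E) = n"
      using that(1) sum_list_cover_parts[of "\<Union>E"] by (simp add: neighborly_def partitions_of_def)
  qed
  have "(\<Sum>xs\<in>neighborly i n. signature xs) = (\<Sum>xs\<in>neighborly i n. \<Sum>E\<in>?C xs. (-1) ^ card E)"
    by (simp add: signature_eq)
  also have "\<dots> = (\<Sum>(xs, E)\<in>Sigma (neighborly i n) ?C. (-1) ^ card E)"
  proof (subst sum.Sigma)
    show "\<forall>xs\<in>neighborly i n. finite (?C xs)"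
    proof
      fix xs assume "xs \<in> neighborly i n"
      then have "?C xs \<subseteq> Pow (edge_pool (3 - i) d)"
        using sub(1) by blast
      then show "finite (?C xs)"
        by (rule finite_subset) simp
    qed
  qed (simp_all add: finite_neighborly)
  also have "\<dots> = (\<Sum>E | E \<in> Pow (edge_pool (3 - i) d) \<and> weight (\<Union>E) = n. (-1) ^ card E)"
  proof (rule sum.reindex_bij_witness[where j = snd and i = "\<lambda>E. (cover_parts (\<Union>E), E)"])
    fix E assume "E \<in> {E. E \<in> Pow (edge_pool (3 - i) d) \<and> weight (\<Union>E) = n}"
    then have E: "E \<subseteq> edge_pool (3 - i) d" "weight (\<Union>E) = n" by auto
    then have E': "E \<subseteq> all_edges" using edge_pool_subset_all_edges by blast
    have "X h \<in> \<Union>E" if "Y h \<in> \<Union>E" for h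
      using that E' by (auto simp: all_edges_def)
    then have "partition_verts (cover_parts (\<Union>E)) = \<Union>E"
      using finite_Union_subset_edge_pool[OF E(1)] by (intro partition_verts_cover_parts)
    then show "(cover_parts (\<Union>E), E) \<in> Sigma (neighborly i n) ?C"
      using cover_parts_neighborly[OF E(1) i] E E' by auto
  next
    fix p assume "p \<in> Sigma (neighborly i n) ?C"
    then obtain xs E where p: "p = (xs, E)" "xs \<in> neighborly i n" "E \<in> ?C xs"
      by blast
    show "(cover_parts (\<Union>(snd p)), snd p) = p"
      "snd p \<in> {E. E \<in> Pow (edge_pool (3 - i) d) \<and> weight (\<Union>E) = n}"
      "(-1) ^ card (snd p) = (case p of (xs, E) \<Rightarrow> (-1 :: int) ^ card E)"
      using sub[OF p(2,3)] by (simp_all add: p(1))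
  qed simp
  also have "\<dots> = (\<Sum>E\<in>Pow (edge_pool (3 - i) d). if weight (\<Union>E) = n then (-1) ^ card E else 0)"
    by (intro sum.inter_filter) simp
  also have "\<dots> = fps_nth (cover_gf d (3 - i)) n"
    unfolding cover_gf_def fps_sum_nth
    by (intro sum.cong refl) (simp add: fps_nth_minus_one_power_mult)
  finally show ?thesis .
qed

section \<open>The product side\<close>

definition RR_parts :: "nat \<Rightarrow> nat set" where
  "RR_parts i = {x. x \<ge> 3 - i \<and>
     ([int x = 0] (mod 5) \<or> [int x = int i] (mod 5) \<or> [int x = - int i] (mod 5))}"

text \<open>Expanding the product selects a set of distinct parts with sign
  \<open>(-1) ^ card A\<close>; no part of a partition of \<open>n\<close> reaches
  \<open>M\<close>.\<close>

lemma sum_distinct_RR_eq: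
  assumes i: "i \<in> {1, 2}" and n: "n < M"
  shows "(\<Sum>xs\<in>distinct_RR i n. (-1) ^ length xs) =
    fps_nth (\<Prod>j\<in>RR_parts i \<inter> {..<M}. 1 - fps_X ^ j :: int fps) n"
proof -
  let ?J = "RR_parts i \<inter> {..<M}"
  have pos: "x > 0" if "x \<in> RR_parts i" for x
    using that i by (auto simp: RR_parts_def)
  have "(\<Sum>xs\<in>distinct_RR i n. (-1) ^ length xs) = (\<Sum>A | A \<in> Pow ?J \<and> \<Sum>A = n. (-1 :: int) ^ card A)"
  proof (rule sum.reindex_bij_witness[where j = set and i = "\<lambda>A. rev (sorted_list_of_set A)"])
    fix xs assume xs: "xs \<in> distinct_RR i n"
    then have d: "distinct xs" "sorted (rev xs)" "sum_list xs = n"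
      by (auto simp: distinct_RR_def partitions_of_def sorted_wrt_rev)
    then show "rev (sorted_list_of_set (set xs)) = xs"
      using sorted_list_of_set.idem_if_sorted_distinct[of "rev xs"] by simp
    have "x \<in> ?J" if "x \<in> set xs" for x
      using that xs n d(3) member_le_sum_list[of x xs] by (auto simp: distinct_RR_def RR_parts_def)
    moreover have "\<Sum>(set xs) = n"
      using d by (simp add: distinct_sum_list_conv_Sum)
    ultimately show "set xs \<in> {A. A \<in> Pow ?J \<and> \<Sum>A = n}" by blast
    show "(-1) ^ card (set xs) = (-1 :: int) ^ length xs"
      using d by (simp add: distinct_card)
  next
    fix A assume A: "A \<in> {A. A \<in> Pow ?J \<and> \<Sum>A = n}"
    then have fin: "finite A" by (auto intro: finite_subset)
    then show "set (rev (sorted_list_of_set A)) = A" by simp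
    have "sum_list (sorted_list_of_set A) = \<Sum>A"
      using fin by (simp add: distinct_sum_list_conv_Sum)
    then show "rev (sorted_list_of_set A) \<in> distinct_RR i n"
      using A fin pos by (auto simp: distinct_RR_def partitions_of_def RR_parts_def sorted_wrt_rev)
  qed
  also have "\<dots> = (\<Sum>A\<in>Pow ?J. if \<Sum>A = n then (-1) ^ card A else 0)"
    by (intro sum.inter_filter) simp
  also have "\<dots> = fps_nth (\<Sum>A\<in>Pow ?J. (\<Prod>j\<in>A. - (fps_X ^ j)) * (\<Prod>j\<in>?J - A. 1)) n"
    unfolding fps_sum_nth
  proof (rule sum.cong)
    fix A
    have "(\<Prod>j\<in>A. - (fps_X ^ j)) = (-1) ^ card A * (fps_X :: int fps) ^ \<Sum>A"
      by (simp add: prod_uminus power_sum)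
    then show "(if \<Sum>A = n then (-1) ^ card A else 0) =
        fps_nth ((\<Prod>j\<in>A. - (fps_X ^ j)) * (\<Prod>j\<in>?J - A. 1) :: int fps) n"
      by (simp add: fps_nth_minus_one_power_mult)
  qed simp
  also have "(\<Sum>A\<in>Pow ?J. (\<Prod>j\<in>A. - (fps_X ^ j)) * (\<Prod>j\<in>?J - A. 1)) =
      (\<Prod>j\<in>?J. - (fps_X ^ j) + 1 :: int fps)"
    by (rule prod_add[symmetric]) simp
  finally show ?thesis by simp
qed

lemma RR_parts_1: "x \<in> RR_parts 1 \<longleftrightarrow> x \<ge> 2 \<and> x mod 5 \<in> {0, 1, 4}"
  unfolding RR_parts_def cong_def by (simp add: zmod_int[of x 5, symmetric, simplified])

lemma RR_parts_2: "x \<in> RR_parts 2 \<longleftrightarrow> x \<ge> 1 \<and> x mod 5 \<in> {0, 2, 3}"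
  unfolding RR_parts_def cong_def by (simp add: zmod_int[of x 5, symmetric, simplified])

lemma prod_Int_lessThan_5_Suc:
  fixes f :: "nat \<Rightarrow> 'a::comm_monoid_mult"
  shows "(\<Prod>j\<in>A \<inter> {..<5 * Suc N + 1}. f j) = (\<Prod>j\<in>A \<inter> {..<5 * N + 1}. f j) *
     (\<Prod>j\<in>A \<inter> {5 * N + 1, 5 * N + 2, 5 * N + 3, 5 * N + 4, 5 * N + 5}. f j)"
proof -
  have "{..<5 * Suc N + 1} =
      {..<5 * N + 1} \<union> {5 * N + 1, 5 * N + 2, 5 * N + 3, 5 * N + 4, 5 * N + 5}"
    by auto
  then show ?thesis
    by (simp only: Int_Un_distrib) (rule prod.union_disjoint; force)
qed

lemma prod_RR_parts_2:
  fixes f :: "nat \<Rightarrow> 'a::comm_monoid_mult"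
  shows "(\<Prod>j\<in>RR_parts 2 \<inter> {..<5 * N + 1}. f j) =
      (\<Prod>m<N. f (5 * m + 3) * f (5 * m + 2) * f (5 * m + 5))"
proof (induction N)
  case 0
  have "RR_parts 2 \<inter> {..<5 * 0 + 1} = {}" by (auto simp: RR_parts_2)
  then show ?case by (simp only: prod.empty) simp
next
  case (Suc N)
  have "5 * N + 1 \<notin> RR_parts 2" "5 * N + 2 \<in> RR_parts 2" "5 * N + 3 \<in> RR_parts 2"
    "5 * N + 4 \<notin> RR_parts 2" "5 * N + 5 \<in> RR_parts 2"
    unfolding RR_parts_2 mod_mult_self4 by simp_all
  then have "RR_parts 2 \<inter> {5 * N + 1, 5 * N + 2, 5 * N + 3, 5 * N + 4, 5 * N + 5} =
      {5 * N + 3, 5 * N + 2, 5 * N + 5}"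
    by blast
  then show ?case
    unfolding prod_Int_lessThan_5_Suc Suc.IH by (simp add: mult.assoc)
qed

text \<open>The bound \<open>x \<ge> 2\<close> excludes 1 from its residue class, so
  \<open>f 1\<close> is supplied separately. At least one block of five is present, since an empty
  product on the right would not contain \<open>f 1\<close>.\<close>

lemma prod_RR_parts_1:
  fixes f :: "nat \<Rightarrow> 'a::comm_monoid_mult"
  shows "f 1 * (\<Prod>j\<in>RR_parts 1 \<inter> {..<5 * Suc N + 1}. f j) =
     (\<Prod>m<Suc N. f (5 * m + 4) * f (5 * m + 1) * f (5 * m + 5))"
proof (induction N)
  case 0
  have "RR_parts 1 \<inter> {..<5 * Suc 0 + 1} = {4, 5}"
  proof (intro equalityI subsetI)
    fix x assume "x \<in> RR_parts 1 \<inter> {..<5 * Suc 0 + 1}"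
    then have "x mod 5 \<in> {0, 1, 4}" "x \<ge> 2" "x < 6"
      unfolding Int_iff RR_parts_1 by auto
    moreover from this have "x = 2 \<or> x = 3 \<or> x = 4 \<or> x = 5"
      by linarith
    ultimately show "x \<in> {4, 5}" by auto
  next
    fix x :: nat assume "x \<in> {4, 5}"
    then show "x \<in> RR_parts 1 \<inter> {..<5 * Suc 0 + 1}"
      unfolding Int_iff RR_parts_1 by auto
  qed
  then show ?case by (simp add: mult_ac)
next
  case (Suc N)
  define K where "K = Suc N"
  \<comment> \<open>Positivity ensures \<open>5 * K + 1 \<ge> 2\<close>, so from the second block on
    the residue 1 is not excluded.\<close>
  have "K > 0" by (simp add: K_def)
  then have "5 * K + 1 \<in> RR_parts 1" "5 * K + 2 \<notin> RR_parts 1" "5 * K + 3 \<notin> RR_parts 1"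
    "5 * K + 4 \<in> RR_parts 1" "5 * K + 5 \<in> RR_parts 1"
    unfolding RR_parts_1 mod_mult_self4 by simp_all
  then have "RR_parts 1 \<inter> {5 * K + 1, 5 * K + 2, 5 * K + 3, 5 * K + 4, 5 * K + 5} =
      {5 * K + 4, 5 * K + 1, 5 * K + 5}"
    by blast
  then have "(\<Prod>j\<in>RR_parts 1 \<inter> {5 * K + 1, 5 * K + 2, 5 * K + 3, 5 * K + 4, 5 * K + 5}. f j) =
      f (5 * K + 4) * f (5 * K + 1) * f (5 * K + 5)"
    by (simp add: mult.assoc)
  then show ?case
    unfolding prod_Int_lessThan_5_Suc[where N = "Suc N"] mult.assoc[symmetric] Suc.IH
    by (simp add: K_def mult.assoc)
qed

section \<open>Comparison of both sides modulo \<open>fps_X ^ Suc n\<close>\<close>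

theorem theorem2:
  fixes i n :: nat
  assumes "i \<in> {1, 2}" and "n > 0"
  shows "(\<Sum>xs\<in>neighborly i n. signature xs) = (\<Sum>xs\<in>distinct_RR i n. (-1) ^ length xs)"
proof -
  define M where "M = Suc n"
  \<comment> \<open>The bound covers the \<open>2 * M\<close> blocks of five exponents that occur in
    the truncated triple product.\<close>
  define P where "P = (\<Prod>j\<in>RR_parts i \<inter> {..<5 * (2 * M) + 1}. 1 - fps_X ^ j :: int fps)"
  have lhs: "(\<Sum>xs\<in>neighborly i n. signature xs) = fps_nth (cover_gf n (3 - i)) n"
    using assms(1) by (intro sum_signature_eq_cover_gf) auto
  have rhs: "(\<Sum>xs\<in>distinct_RR i n. (-1) ^ length xs) = fps_nth P n"
    unfolding P_def using assms(1) by (intro sum_distinct_RR_eq) (auto simp: M_def)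
  have "fps_cong M (cover_gf n (3 - i)) P"
  proof (cases "i = 2")
    case True
    have "fps_cong M (cover_gf n (Suc 0)) (rogers_S fps_X 0 (Suc (2 * M)))"
      using cover_gf_cong_rogers[of 0 n "Suc (2 * M)"] by (simp add: M_def)
    also have "fps_cong M \<dots> P"
      unfolding P_def True prod_RR_parts_2 by (rule rogers_S_0_cong)
    finally show ?thesis using True by simp
  next
    case False
    then have i: "i = 1" using assms(1) by simp
    have "fps_cong (Suc 1 + n) (cover_gf n (Suc 1)) (rogers_S fps_X 1 (Suc (2 * M)))"
      using cover_gf_cong_rogers[of 1 n "Suc (2 * M)"] assms(2) by (simp add: M_def)
    then have "fps_cong M (cover_gf n (Suc 1)) (rogers_S fps_X 1 (Suc (2 * M)))"
      by (rule fps_cong_mono) (simp add: M_def)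
    \<comment> \<open>For smallest part 2 the series is taken at \<open>x = q\<close>. Multiplying
      by \<open>1 - fps_X\<close> moves it to \<open>rogers_T\<close> at \<open>x = 1\<close>; the
      same factor is the one for the excluded part 1, so it cancels at the end.\<close>
    then have "fps_cong M ((1 - fps_X ^ 1) * cover_gf n (Suc 1))
        ((1 - fps_X ^ 1) * rogers_S fps_X 1 (Suc (2 * M)))"
      by (intro fps_cong_mult fps_cong_refl)
    also have "fps_cong M \<dots> (rogers_T fps_X 0 (Suc (2 * M)))"
      using fps_cong_mono[OF rogers_T_cong[of "Suc (2 * M)" 0, where 'a=int], of M]
      by (simp add: fps_cong_sym)
    also have "fps_cong M \<dots> ((1 - fps_X ^ 1) * P)"
    proof -
      obtain N where N: "2 * M = Suc N" by (simp add: M_def)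
      show ?thesis
        using rogers_T_0_cong[of M, where 'a=int] unfolding P_def i N
          prod_RR_parts_1[of "\<lambda>j. 1 - fps_X ^ j :: int fps"] .
    qed
    finally have "fps_cong M (cover_gf n (Suc 1)) P"
      by (rule fps_cong_mult_cancel) simp
    then show ?thesis using i by (simp add: numeral_2_eq_2)
  qed
  then show ?thesis
    unfolding lhs rhs by (simp add: fps_cong_def M_def)
qed

end
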